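(* The parameterized problem HS$(m-k,k)$ admits a kernel with at most $k4^k$ vertices and at most $k4^k$ edges. That is, there is a polynomial-time algorithm that, given an instance $(H,k)$, outputs an equivalent instance $(H',k')$ (Yes-instance iff $(H,k)$ is), with $k'$ bounded by a function of $k$, such that $H'$ has at most $k4^k$ vertices and at most $k4^k$ edges.
   Context: A hypergraph $H=(V,\mathcal F)$ has nonempty vertex set $V$ and a family $\mathcal F$ of nonempty subsets of $V$ (edges), parallel edges allowed; $n=|V|$, $m=|\mathcal F|$. A hitting set is a set $S\subseteq V$ meeting every edge. HS$(m-k,k)$: given a hypergraph $H$ and an integer $k$ (the parameter), decide whether $H$ has a hitting set of size at most $m-k$.
   Formalization: For k ≤ 0 the bound k4^k on the vertices cannot hold, since a hypergraph has a nonempty vertex set; there the kernel is instead required to have at most 1 vertex and 0 edges. For k ≥ 1 the bounds are exactly k4^k. *)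

theory Defs
  imports Complex_Main "HOL-Library.Log_Nat"
begin

section \<open>Hypergraphs and hitting sets\<close>

text \<open>
  The family of edges is a list, i.e. a family indexed by \<open>{..<m}\<close> with \<open>m = length F\<close>;
  repeated entries are parallel edges.
\<close>

definition hypergraph :: "'a set \<Rightarrow> 'a set list \<Rightarrow> bool" where
  "hypergraph V F \<longleftrightarrow> finite V \<and> V \<noteq> {} \<and> (\<forall>e\<in>set F. e \<noteq> {} \<and> e \<subseteq> V)"

definition hitting_set :: "'a set \<Rightarrow> 'a set list \<Rightarrow> 'a set \<Rightarrow> bool" where
  "hitting_set V F S \<longleftrightarrow> S \<subseteq> V \<and> (\<forall>e\<in>set F. S \<inter> e \<noteq> {})"

text \<open>The question of HS\<open>(m-k,k)\<close>; the subtraction takes place in the integers.\<close>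

definition HS_yes :: "'a set \<Rightarrow> 'a set list \<Rightarrow> int \<Rightarrow> bool" where
  "HS_yes V F k \<longleftrightarrow> (\<exists>S. hitting_set V F S \<and> int (card S) \<le> int (length F) - k)"


section \<open>Random access machines and polynomial time\<close>

text \<open>
  The random access machine of Cook and Reckhow: integer registers, all initially zero, a
  read-only input tape and a write-only output tape, both carrying integers.  Every
  instruction costs one time unit.  There is no multiplication, so the bit length of the
  largest register value grows by at most one per step, and polynomial time on this machine
  coincides with polynomial time on Turing machines.

  Reading beyond the end of the input yields 0, and negative indirect addresses are
  read as 0.  The machine halts when the program counter leaves the program.
\<close>

datatype instr =
    Const nat int       \<comment> \<open>\<open>X\<^sub>i := c\<close>\<close>
  | Add nat nat nat     \<comment> \<open>\<open>X\<^sub>i := X\<^sub>j + X\<^sub>l\<close>\<close>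
  | Sub nat nat nat     \<comment> \<open>\<open>X\<^sub>i := X\<^sub>j - X\<^sub>l\<close>\<close>
  | Load nat nat        \<comment> \<open>\<open>X\<^sub>i := X[X\<^sub>j]\<close>\<close>
  | Store nat nat       \<comment> \<open>\<open>X[X\<^sub>i] := X\<^sub>j\<close>\<close>
  | JumpPos nat nat     \<comment> \<open>if \<open>X\<^sub>i > 0\<close> continue at the instruction with the given number\<close>
  | Read nat            \<comment> \<open>\<open>X\<^sub>i :=\<close> next input\<close>
  | Write nat           \<comment> \<open>append \<open>X\<^sub>i\<close> to the output\<close>

text \<open>Program counter, registers, remaining input, output so far.\<close>

type_synonym config = "nat \<times> (nat \<Rightarrow> int) \<times> int list \<times> int list"

fun exec :: "instr \<Rightarrow> config \<Rightarrow> config" where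
  "exec (Const i c) (pc, X, xs, ys) = (Suc pc, X(i := c), xs, ys)"
| "exec (Add i j l) (pc, X, xs, ys) = (Suc pc, X(i := X j + X l), xs, ys)"
| "exec (Sub i j l) (pc, X, xs, ys) = (Suc pc, X(i := X j - X l), xs, ys)"
| "exec (Load i j) (pc, X, xs, ys) = (Suc pc, X(i := X (nat (X j))), xs, ys)"
| "exec (Store i j) (pc, X, xs, ys) = (Suc pc, X(nat (X i) := X j), xs, ys)"
| "exec (JumpPos i l) (pc, X, xs, ys) = (if X i > 0 then l else Suc pc, X, xs, ys)"
| "exec (Read i) (pc, X, xs, ys) =
     (Suc pc, X(i := (case xs of [] \<Rightarrow> 0 | x # _ \<Rightarrow> x)), tl xs, ys)"
| "exec (Write i) (pc, X, xs, ys) = (Suc pc, X, xs, ys @ [X i])"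

definition step :: "instr list \<Rightarrow> config \<Rightarrow> config" where
  "step P c = (if fst c < length P then exec (P ! fst c) c else c)"

text \<open>
  A halted configuration is a fixed point of \<open>step P\<close>, so the following says that \<open>P\<close> halts
  on input \<open>xs\<close> after at most \<open>t\<close> steps with output \<open>ys\<close>.
\<close>

definition computes_within :: "instr list \<Rightarrow> int list \<Rightarrow> int list \<Rightarrow> nat \<Rightarrow> bool" where
  "computes_within P xs ys t \<longleftrightarrow>
     (\<exists>pc X zs. (step P ^^ t) (0, \<lambda>_. 0, xs, []) = (pc, X, zs, ys) \<and> length P \<le> pc)"

text \<open>Binary length of the input: for each integer its binary digits and one sign bit.\<close>

definition input_size :: "int list \<Rightarrow> nat" where
  "input_size xs = (\<Sum>x\<leftarrow>xs. 1 + floorlog 2 (nat \<bar>x\<bar>))"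

definition polytime_computable_on ::
    "'i set \<Rightarrow> ('i \<Rightarrow> int list) \<Rightarrow> ('i \<Rightarrow> 'i) \<Rightarrow> bool" where
  "polytime_computable_on D enc f \<longleftrightarrow>
     (\<exists>P c d. \<forall>x\<in>D. computes_within P (enc x) (enc (f x)) (c * input_size (enc x) ^ d + c))"


section \<open>Instances of HS(m-k,k)\<close>

text \<open>
  As an input to an algorithm, a hypergraph has vertex set \<open>{..<n}\<close>; the triple \<open>(n, F, k)\<close>
  stands for the hypergraph \<open>({..<n}, F)\<close> with parameter \<open>k\<close>.
\<close>

type_synonym instance_HS = "nat \<times> nat set list \<times> int"

definition instances_HS :: "instance_HS set" where
  "instances_HS = {(n, F, k). hypergraph {..<n} F}"

text \<open>
  An instance is written as \<open>k\<close>, \<open>n\<close>, \<open>m\<close>, followed by the incidence matrix, edge by edge.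
\<close>

definition encode_HS :: "instance_HS \<Rightarrow> int list" where
  "encode_HS = (\<lambda>(n, F, k). k # int n # int (length F) #
     concat (map (\<lambda>e. map (\<lambda>v. of_bool (v \<in> e)) [0..<n]) F))"

end

theory Submission
  imports Defs
begin

text \<open>
  Let the excess of a vertex set be the number of edges that it hits minus its size.  Adding one
  vertex for every edge that is not hit shows that the instance is a Yes-instance iff some set has
  excess at least \<open>k\<close>.  Pick greedily all vertices that hit at least two new edges; if the
  resulting set \<open>C\<close> has excess at least \<open>k\<close>, the answer is Yes.  Otherwise the set \<open>B\<close> of edges hit
  by \<open>C\<close> has at most \<open>2k - 2\<close> elements, and every vertex hits at most one edge outside \<open>B\<close>.
  Among the vertices hitting the same edges of \<open>B\<close> it suffices to keep \<open>k + 1\<close> with pairwise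
  different sets of incident edges: an optimal set can be assumed to have at most \<open>k\<close> elements, and
  then each of its vertices can be exchanged for a kept one.

  The machine program is written in a language whose only loops are counting loops with fixed
  bounds, so that every program runs in time polynomial in these bounds.
\<close>

section \<open>Excess of a vertex set\<close>

definition hits :: "'a set list \<Rightarrow> 'a set \<Rightarrow> nat set" where
  "hits F S = {e. e < length F \<and> S \<inter> F ! e \<noteq> {}}"

definition excess :: "'a set list \<Rightarrow> 'a set \<Rightarrow> int" where
  "excess F S = int (card (hits F S)) - int (card S)"

lemma hits_empty [simp]: "hits F {} = {}"
  by (simp add: hits_def)

lemma finite_hits [simp]: "finite (hits F S)"
  by (simp add: hits_def)

lemma hits_insert: "hits F (insert v S) = hits F {v} \<union> hits F S"
  by (auto simp: hits_def)

lemma hits_UN: "hits F S = (\<Union>v\<in>S. hits F {v})"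
  by (auto simp: hits_def)

lemma hits_mono: "S \<subseteq> T \<Longrightarrow> hits F S \<subseteq> hits F T"
  by (auto simp: hits_def)

lemma hits_subset: "hits F S \<subseteq> {..<length F}"
  by (auto simp: hits_def)

lemma HS_yes_iff_excess:
  assumes "hypergraph V F"
  shows "HS_yes V F k \<longleftrightarrow> (\<exists>S\<subseteq>V. k \<le> excess F S)"
proof
  assume "HS_yes V F k"
  then obtain S where S: "hitting_set V F S" "int (card S) \<le> int (length F) - k"
    by (auto simp: HS_yes_def)
  have "hits F S = {..<length F}" using S(1) by (auto simp: hits_def hitting_set_def)
  then show "\<exists>S\<subseteq>V. k \<le> excess F S"
    using S by (intro exI[of _ S]) (auto simp: excess_def hitting_set_def)
next
  assume "\<exists>S\<subseteq>V. k \<le> excess F S"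
  then obtain S where S: "S \<subseteq> V" "k \<le> excess F S" by blast
  have edge: "F ! e \<noteq> {} \<and> F ! e \<subseteq> V" if "e < length F" for e
    using assms that by (auto simp: hypergraph_def)
  define w where "w e = (SOME v. v \<in> F ! e)" for e
  have w: "w e \<in> F ! e" if "e < length F" for e
    unfolding w_def using edge[OF that] by (simp add: some_in_eq)
  let ?R = "{..<length F} - hits F S"
  let ?T = "S \<union> w ` ?R"
  have "hitting_set V F ?T"
    unfolding hitting_set_def
  proof (intro conjI ballI)
    show "?T \<subseteq> V" using S(1) w edge by auto
    fix f assume "f \<in> set F"
    then obtain e where e: "e < length F" "f = F ! e" by (metis in_set_conv_nth)
    then show "?T \<inter> f \<noteq> {}" using w[OF e(1)] by (cases "e \<in> hits F S") (auto simp: hits_def)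
  qed
  moreover have "card ?T \<le> card S + card ?R"
    by (meson card_Un_le card_image_le finite_Diff finite_lessThan add_left_mono order_trans)
  then have "int (card ?T) \<le> int (length F) - k"
    using S(2) card_mono[OF _ hits_subset[of F S]]
    by (simp add: excess_def card_Diff_subset hits_subset)
  ultimately show "HS_yes V F k" by (auto simp: HS_yes_def)
qed

text \<open>
  As long as some vertex hits at most one edge on its own, deleting it does not decrease the
  excess; otherwise any subset of size \<open>k\<close> hits at least \<open>2k\<close> edges.
\<close>

lemma excess_small_subset:
  assumes "finite S" "k \<le> excess F S" "0 \<le> k"
  shows "\<exists>T\<subseteq>S. int (card T) \<le> k \<and> k \<le> excess F T"
  using assms(1,2)
proof (induction S rule: finite_psubset_induct)
  case (psubset S)
  show ?case
  proof (cases "int (card S) \<le> k")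
    case True
    then show ?thesis using psubset.prems by blast
  next
    case False
    have "\<exists>v\<in>S. k \<le> excess F (S - {v})"
    proof (cases "\<exists>v\<in>S. card (hits F S - hits F (S - {v})) \<le> 1")
      case True
      then obtain v where v: "v \<in> S" "card (hits F S - hits F (S - {v})) \<le> 1" by blast
      have sub: "hits F (S - {v}) \<subseteq> hits F S" by (intro hits_mono) auto
      then have "card (hits F S) = card (hits F (S - {v})) + card (hits F S - hits F (S - {v}))"
        using card_mono[OF finite_hits sub] card_Diff_subset[OF finite_hits sub] by simp
      moreover have "card S = Suc (card (S - {v}))"
        using card_Suc_Diff1[OF psubset.hyps v(1)] by simp
      ultimately have "k \<le> excess F (S - {v})"
        using psubset.prems v(2) by (simp add: excess_def)
      then show ?thesis using v(1) by blast
    next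
      case own: False
      define own where "own w = hits F S - hits F (S - {w})" for w
      have "S \<noteq> {}" using False assms(3) by auto
      then obtain v where v: "v \<in> S" by blast
      let ?T = "S - {v}"
      have hit: "e \<in> hits F {w}" if "e \<in> own w" for e w
        using that by (auto simp: own_def hits_def)
      have disj: "own w \<inter> own w' = {}" if "w \<in> S" "w \<noteq> w'" for w w'
      proof -
        have "hits F {w} \<subseteq> hits F (S - {w'})" using that by (intro hits_mono) auto
        then show ?thesis using hit by (auto simp: own_def)
      qed
      have "2 * card ?T = (\<Sum>w\<in>?T. 2)" by simp
      also have "\<dots> \<le> (\<Sum>w\<in>?T. card (own w))"
        using own by (intro sum_mono) (auto simp: own_def not_le)
      also have "\<dots> = card (\<Union>w\<in>?T. own w)"
        using psubset.hyps disj by (intro card_UN_disjoint[symmetric]) (auto simp: own_def)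
      also have "\<dots> \<le> card (hits F ?T)"
        using hit hits_UN[of F ?T] by (intro card_mono finite_hits) blast
      finally have "k \<le> excess F ?T"
        using False v psubset.hyps by (simp add: excess_def card_Diff_singleton)
      then show ?thesis using v by blast
    qed
    then obtain v where v: "v \<in> S" "k \<le> excess F (S - {v})" by blast
    then have "\<exists>T\<subseteq>S - {v}. int (card T) \<le> k \<and> k \<le> excess F T"
      by (intro psubset.IH) auto
    then show ?thesis by blast
  qed
qed


section \<open>The kernel\<close>

primrec greedy :: "nat set list \<Rightarrow> nat \<Rightarrow> nat set" where
  "greedy F 0 = {}"
| "greedy F (Suc v) = (if 2 \<le> card (hits F {v} - hits F (greedy F v))
     then insert v (greedy F v) else greedy F v)"

lemma greedy_subset: "greedy F v \<subseteq> {..<v}"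
  by (induction v) auto

lemma finite_greedy [simp]: "finite (greedy F v)"
  using finite_subset[OF greedy_subset] by blast

lemma not_in_greedy [simp]: "v \<notin> greedy F v"
  using greedy_subset by blast

lemma card_hits_insert:
  "card (hits F (insert v S)) = card (hits F S) + card (hits F {v} - hits F S)"
proof -
  have "hits F (insert v S) = hits F S \<union> (hits F {v} - hits F S)"
    using hits_insert[of F v S] by blast
  moreover have "hits F S \<inter> (hits F {v} - hits F S) = {}" by blast
  ultimately show ?thesis by (metis card_Un_disjoint finite_Diff finite_hits)
qed

lemma card_greedy: "2 * card (greedy F v) \<le> card (hits F (greedy F v))"
  by (induction v) (auto simp: card_hits_insert)

lemma excess_greedy_Suc:
  "excess F (insert v (greedy F v)) =
    excess F (greedy F v) + int (card (hits F {v} - hits F (greedy F v))) - 1"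
  by (simp add: excess_def card_hits_insert)

lemma greedy_mono: "u \<le> v \<Longrightarrow> greedy F u \<subseteq> greedy F v"
  by (rule lift_Suc_mono_le[of "greedy F"]) auto

lemma card_outside_greedy:
  assumes "u < v"
  shows "card (hits F {u} - hits F (greedy F v)) \<le> 1"
proof (cases "u \<in> greedy F (Suc u)")
  case True
  then have "u \<in> greedy F v" using greedy_mono[of "Suc u" v F] assms by auto
  then have "hits F {u} - hits F (greedy F v) = {}" using hits_mono[of "{u}"] by auto
  then show ?thesis by (simp only: card.empty)
next
  case False
  then have "card (hits F {u} - hits F (greedy F u)) \<le> 1"
    by (auto split: if_splits)
  moreover have "hits F (greedy F u) \<subseteq> hits F (greedy F v)"
    using assms by (intro hits_mono greedy_mono) auto
  then have "card (hits F {u} - hits F (greedy F v)) \<le> card (hits F {u} - hits F (greedy F u))"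
    by (intro card_mono) auto
  ultimately show ?thesis by linarith
qed

abbreviation same_type :: "nat set list \<Rightarrow> nat set \<Rightarrow> nat \<Rightarrow> nat \<Rightarrow> bool" where
  "same_type F B u v \<equiv> hits F {u} \<inter> B = hits F {v} \<inter> B"

primrec keep :: "nat set list \<Rightarrow> int \<Rightarrow> nat set \<Rightarrow> nat \<Rightarrow> nat set" where
  "keep F k B 0 = {}"
| "keep F k B (Suc v) = (if (\<forall>u\<in>keep F k B v. hits F {u} \<noteq> hits F {v}) \<and>
       int (card {u \<in> keep F k B v. same_type F B u v}) \<le> k
     then insert v (keep F k B v) else keep F k B v)"

lemma keep_subset: "keep F k B v \<subseteq> {..<v}"
  by (induction v) auto

lemma finite_keep [simp]: "finite (keep F k B v)"
  using finite_subset[OF keep_subset] by blast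

lemma keep_mono: "u \<le> v \<Longrightarrow> keep F k B u \<subseteq> keep F k B v"
  by (rule lift_Suc_mono_le[of "keep F k B"]) auto

lemma inj_on_keep: "inj_on (\<lambda>v. hits F {v}) (keep F k B v)"
  by (induction v) (auto simp: inj_on_def)

lemma card_keep_type:
  assumes "0 \<le> k"
  shows "card {u \<in> keep F k B v. hits F {u} \<inter> B = T} \<le> nat (k + 1)"
proof (induction v)
  case (Suc v)
  have "v \<notin> keep F k B v" using keep_subset by blast
  show ?case
  proof (cases "v \<in> keep F k B (Suc v) \<and> hits F {v} \<inter> B = T")
    case True
    then have "int (card {u \<in> keep F k B v. hits F {u} \<inter> B = T}) \<le> k"
      using \<open>v \<notin> keep F k B v\<close> by (auto split: if_splits)
    moreover have "{u \<in> keep F k B (Suc v). hits F {u} \<inter> B = T} \<subseteq>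
        insert v {u \<in> keep F k B v. hits F {u} \<inter> B = T}" by auto
    then have "card {u \<in> keep F k B (Suc v). hits F {u} \<inter> B = T} \<le>
        card (insert v {u \<in> keep F k B v. hits F {u} \<inter> B = T})"
      by (intro card_mono) auto
    ultimately show ?thesis using \<open>v \<notin> keep F k B v\<close> by simp
  next
    case False
    then have "{u \<in> keep F k B (Suc v). hits F {u} \<inter> B = T} =
        {u \<in> keep F k B v. hits F {u} \<inter> B = T}"
      by auto
    then show ?thesis using Suc.IH by simp
  qed
qed simp

lemma card_keep:
  assumes "0 \<le> k" "finite B"
  shows "card (keep F k B v) \<le> 2 ^ card B * nat (k + 1)"
proof -
  let ?T = "\<lambda>T. {u \<in> keep F k B v. hits F {u} \<inter> B = T}"
  have "keep F k B v \<subseteq> (\<Union>T\<in>Pow B. ?T T)"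
  proof
    fix u assume "u \<in> keep F k B v"
    then show "u \<in> (\<Union>T\<in>Pow B. ?T T)" by (intro UN_I[of "hits F {u} \<inter> B"]) simp_all
  qed
  then have "card (keep F k B v) \<le> card (\<Union>T\<in>Pow B. ?T T)"
    by (rule card_mono[rotated]) (simp add: assms(2))
  also have "\<dots> \<le> (\<Sum>T\<in>Pow B. card (?T T))"
    by (rule card_UN_le) (simp add: assms(2))
  also have "\<dots> \<le> (\<Sum>T\<in>Pow B. nat (k + 1))"
    by (intro sum_mono card_keep_type[OF assms(1)])
  finally show ?thesis by (simp add: card_Pow assms(2))
qed

lemma keep_rejected:
  assumes "v < n" "v \<notin> keep F k B n"
  shows "(\<exists>u\<in>keep F k B n. hits F {u} = hits F {v}) \<or>
    k < int (card {u \<in> keep F k B n. same_type F B u v})"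
proof -
  have sub: "keep F k B (Suc v) \<subseteq> keep F k B n" "keep F k B v \<subseteq> keep F k B n"
    using keep_mono[of "Suc v" n F k B] keep_mono[of v n F k B] assms(1)
    by (simp_all del: keep.simps)
  have "v \<notin> keep F k B (Suc v)" using sub(1) assms(2) by blast
  then have "\<not> ((\<forall>u\<in>keep F k B v. hits F {u} \<noteq> hits F {v}) \<and>
       int (card {u \<in> keep F k B v. same_type F B u v}) \<le> k)" (is "\<not> ?accept")
  proof (rule contrapos_nn)
    assume ?accept
    then have "keep F k B (Suc v) = insert v (keep F k B v)" unfolding keep.simps by (rule if_P)
    then show "v \<in> keep F k B (Suc v)" by (simp only: insertI1)
  qed
  moreover have "card {u \<in> keep F k B v. same_type F B u v} \<le>
      card {u \<in> keep F k B n. same_type F B u v}"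
    using sub(2) by (intro card_mono) auto
  ultimately show ?thesis
  proof (cases "\<exists>u\<in>keep F k B v. hits F {u} = hits F {v}")
    case True
    then show ?thesis using sub(2) by (meson subsetD)
  qed simp
qed

text \<open>
  Among more than \<open>k\<close> kept vertices of one type, all but at most one hit an edge outside \<open>B\<close>,
  and these edges are different; the other members of \<open>S\<close> hit fewer than \<open>k\<close> edges outside \<open>B\<close>.
\<close>

lemma exchange_into_keep:
  assumes one: "\<And>u. u < n \<Longrightarrow> card (hits F {u} - B) \<le> 1"
    and "S \<subseteq> {..<n}" "int (card S) \<le> k" "v \<in> S" "v \<notin> keep F k B n" "finite B"
  shows "\<exists>u\<in>keep F k B n. card (hits F S) \<le> card (hits F (insert u (S - {v})))"
proof -
  let ?K = "keep F k B n" and ?T = "S - {v}"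
  have fin: "finite S" using assms(2) finite_subset by blast
  have S: "hits F S = hits F {v} \<union> hits F ?T"
    using hits_insert[of F v ?T] assms(4) by (simp add: insert_absorb)
  have "v < n" using assms(2,4) by auto
  from keep_rejected[OF this assms(5)] show ?thesis
  proof
    assume "\<exists>u\<in>?K. hits F {u} = hits F {v}"
    then show ?thesis using S by (metis hits_insert order_refl)
  next
    let ?Q = "{u \<in> ?K. same_type F B u v}"
    assume big: "k < int (card ?Q)"
    let ?X = "hits F ?T - B"
    have "?X = (\<Union>w\<in>?T. hits F {w} - B)" unfolding hits_UN[of F ?T] by blast
    then have "card ?X \<le> (\<Sum>w\<in>?T. card (hits F {w} - B))"
      using card_UN_le[of ?T "\<lambda>w. hits F {w} - B"] fin by simp
    also have "\<dots> \<le> (\<Sum>w\<in>?T. 1)" using assms(2) by (intro sum_mono one) auto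
    finally have X: "card ?X < card S"
      using card_Suc_Diff1[OF fin assms(4)] by simp
    have "\<exists>u\<in>?Q. \<not> hits F {u} - B \<subseteq> ?X"
    proof (rule ccontr)
      assume "\<not> ?thesis"
      then have sub: "hits F {u} - B \<subseteq> ?X" if "u \<in> ?Q" for u using that by blast
      have "(\<lambda>u. hits F {u} - B) ` ?Q \<subseteq> insert {} ((\<lambda>x. {x}) ` ?X)"
      proof
        fix Y assume "Y \<in> (\<lambda>u. hits F {u} - B) ` ?Q"
        then obtain u where u: "u \<in> ?Q" "Y = hits F {u} - B" by blast
        then have "card Y \<le> 1" using one keep_subset by blast
        then have "x = y" if "x \<in> Y" "y \<in> Y" for x y
          using that u(2) card_le_Suc0_iff_eq[of Y] by simp
        then have "Y = {} \<or> (\<exists>x. Y = {x})" by blast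
        then show "Y \<in> insert {} ((\<lambda>x. {x}) ` ?X)" using sub[OF u(1)] u(2) by blast
      qed
      then have "card ((\<lambda>u. hits F {u} - B) ` ?Q) \<le> card (insert {} ((\<lambda>x. {x}) ` ?X))"
        by (intro card_mono) auto
      also have "\<dots> \<le> Suc (card ?X)"
        using card_image_le[of ?X "\<lambda>x. {x}"] by (simp add: card_insert_if)
      also have "card ((\<lambda>u. hits F {u} - B) ` ?Q) = card ?Q"
      proof (rule card_image, rule inj_onI)
        fix u w assume uw: "u \<in> ?Q" "w \<in> ?Q" "hits F {u} - B = hits F {w} - B"
        then have "hits F {u} \<inter> B = hits F {w} \<inter> B" by simp
        then have "hits F {u} = hits F {w}" using uw(3) by (metis Int_Diff_Un)
        then show "u = w" using uw(1,2) by (intro inj_onD[OF inj_on_keep[of F k B n]]) simp_all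
      qed
      finally show False using big X assms(3) by simp
    qed
    then obtain u e where u: "u \<in> ?K" "same_type F B u v" "e \<in> hits F {u}" "e \<notin> B" "e \<notin> ?X"
      by blast
    let ?S' = "insert u ?T"
    have split: "card Y = card (Y \<inter> B) + card (Y - B)" if "finite Y" for Y :: "nat set"
      using that card_Int_Diff by blast
    have "hits F S \<inter> B = hits F ?S' \<inter> B"
      using u(2) unfolding S hits_insert[of F u ?T] by blast
    moreover have "card (hits F S - B) \<le> card (hits F ?S' - B)"
    proof -
      have "hits F S - B = ?X \<union> (hits F {v} - B)" unfolding S by blast
      then have "card (hits F S - B) \<le> card ?X + card (hits F {v} - B)"
        by (simp only: card_Un_le)
      also have "\<dots> \<le> card ?X + 1" using one[OF \<open>v < n\<close>] by simp
      also have "\<dots> = card (insert e ?X)" using u(5) by simp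
      also have "\<dots> \<le> card (hits F ?S' - B)"
        unfolding hits_insert[of F u ?T] using u(3,4) by (intro card_mono) auto
      finally show ?thesis .
    qed
    ultimately have "card (hits F S) \<le> card (hits F ?S')"
      using split[of "hits F S"] split[of "hits F ?S'"] by simp
    then show ?thesis using u(1) by blast
  qed
qed

lemma excess_in_keep:
  assumes one: "\<And>u. u < n \<Longrightarrow> card (hits F {u} - B) \<le> 1"
    and "finite B" "0 \<le> k" "S \<subseteq> {..<n}" "k \<le> excess F S"
  shows "\<exists>T\<subseteq>keep F k B n. k \<le> excess F T"
proof -
  let ?K = "keep F k B n"
  have "finite S" using assms(4) finite_subset by blast
  from excess_small_subset[OF this assms(5,3)]
  obtain S0 where S0: "S0 \<subseteq> S" "int (card S0) \<le> k" "k \<le> excess F S0" by blast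
  have "\<exists>T\<subseteq>?K. k \<le> excess F T"
    if "R \<subseteq> {..<n}" "int (card R) \<le> k" "k \<le> excess F R" for R
    using that
  proof (induction "card (R - ?K)" arbitrary: R rule: less_induct)
    case less
    have fin: "finite R" using less.prems(1) finite_subset by blast
    show ?case
    proof (cases "R \<subseteq> ?K")
      case False
      then obtain v where v: "v \<in> R" "v \<notin> ?K" by blast
      obtain u where u: "u \<in> ?K" "card (hits F R) \<le> card (hits F (insert u (R - {v})))"
        using exchange_into_keep[OF one less.prems(1,2) v assms(2)] by blast
      let ?R = "insert u (R - {v})"
      have card: "card ?R \<le> card R"
        using card_Suc_Diff1[OF fin v(1)] fin by (simp add: card_insert_if)
      have "?R - ?K = (R - ?K) - {v}" using u(1) by auto
      then have "?R - ?K \<subset> R - ?K" using v by auto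
      then have "card (?R - ?K) < card (R - ?K)" using fin by (intro psubset_card_mono) auto
      then show ?thesis
      proof (rule less.hyps)
        show "?R \<subseteq> {..<n}" using less.prems(1) u(1) keep_subset by blast
        show "int (card ?R) \<le> k" using card less.prems(2) by simp
        show "k \<le> excess F ?R" using less.prems(3) u(2) card by (simp add: excess_def)
      qed
    qed (use less.prems in blast)
  qed
  then show ?thesis using S0 assms(4) by blast
qed

definition induced :: "nat \<Rightarrow> nat set list \<Rightarrow> nat set \<Rightarrow> nat \<times> nat set list" where
  "induced n F K = (let vs = filter (\<lambda>v. v \<in> K) [0..<n] in
     (length vs, map (\<lambda>e. {j. j < length vs \<and> vs ! j \<in> F ! e})
       (filter (\<lambda>e. e \<in> hits F K) [0..<length F])))"

lemma induced_correct:
  assumes "K \<subseteq> {..<n}" "K \<noteq> {}" "induced n F K = (n', F')"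
  shows "hypergraph {..<n'} F'" "n' = card K" "length F' = card (hits F K)"
    and "HS_yes {..<n'} F' k \<longleftrightarrow> (\<exists>S\<subseteq>K. k \<le> excess F S)"
proof -
  define vs where "vs = filter (\<lambda>v. v \<in> K) [0..<n]"
  define es where "es = filter (\<lambda>e. e \<in> hits F K) [0..<length F]"
  have n': "n' = length vs" and F': "F' = map (\<lambda>e. {j. j < length vs \<and> vs ! j \<in> F ! e}) es"
    using assms(3) by (auto simp: induced_def vs_def es_def Let_def)
  have vs: "distinct vs" "set vs = K" using assms(1) by (auto simp: vs_def)
  have es: "distinct es" "set es = hits F K" using hits_subset by (auto simp: es_def)
  show card: "n' = card K" "length F' = card (hits F K)"
    using distinct_card[OF vs(1)] distinct_card[OF es(1)] vs(2) es(2) by (simp_all add: n' F')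
  have "f \<noteq> {} \<and> f \<subseteq> {..<n'}" if "f \<in> set F'" for f
  proof -
    from that obtain e where e: "e \<in> hits F K" "f = {j. j < length vs \<and> vs ! j \<in> F ! e}"
      by (auto simp: F' es(2))
    then obtain v where "v \<in> set vs" "v \<in> F ! e" by (auto simp: hits_def vs(2))
    then show ?thesis using e by (auto simp: in_set_conv_nth n')
  qed
  moreover have "n' \<noteq> 0" using assms(1,2) card(1) finite_subset by fastforce
  ultimately show hyp: "hypergraph {..<n'} F'" by (auto simp: hypergraph_def)
  have excess: "excess F' S = excess F ((!) vs ` S)" if S: "S \<subseteq> {..<n'}" for S
  proof -
    have inj: "inj_on ((!) vs) S" using vs(1) S by (intro inj_on_nth) (auto simp: n')
    have hit: "i \<in> hits F' S \<longleftrightarrow> i < length es \<and> es ! i \<in> hits F ((!) vs ` S)" for i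
    proof -
      have "es ! i < length F" if "i < length es"
        using nth_mem[OF that] es(2) by (auto simp: hits_def)
      then show ?thesis using S by (auto simp: hits_def F' n' disjoint_iff subset_iff)
    qed
    have "(!) vs ` S \<subseteq> K" using S vs(2) by (auto simp: n')
    then have sub: "hits F ((!) vs ` S) \<subseteq> set es" using hits_mono es(2) by blast
    have "(!) es ` hits F' S = hits F ((!) vs ` S)"
    proof
      show "(!) es ` hits F' S \<subseteq> hits F ((!) vs ` S)" using hit by blast
      show "hits F ((!) vs ` S) \<subseteq> (!) es ` hits F' S"
      proof
        fix e assume e: "e \<in> hits F ((!) vs ` S)"
        with sub obtain i where "i < length es" "es ! i = e" by (metis in_set_conv_nth subsetD)
        then show "e \<in> (!) es ` hits F' S" using e hit by blast
      qed
    qed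
    moreover have "inj_on ((!) es) (hits F' S)"
      using es(1) by (intro inj_on_nth) (auto simp: hit)
    ultimately have "card (hits F ((!) vs ` S)) = card (hits F' S)"
      by (metis card_image)
    then show ?thesis using card_image[OF inj] by (simp add: excess_def)
  qed
  have image: "(!) vs ` {..<n'} = K"
    using vs(2) by (auto simp: n' in_set_conv_nth)
  have "(\<exists>S\<subseteq>{..<n'}. k \<le> excess F' S) \<longleftrightarrow> (\<exists>S\<subseteq>K. k \<le> excess F S)"
  proof
    assume "\<exists>S\<subseteq>{..<n'}. k \<le> excess F' S"
    then show "\<exists>S\<subseteq>K. k \<le> excess F S" using excess image by (metis image_mono)
  next
    assume "\<exists>S\<subseteq>K. k \<le> excess F S"
    then obtain S where S: "S \<subseteq> (!) vs ` {..<n'}" "k \<le> excess F S" using image by blast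
    then obtain R where "R \<subseteq> {..<n'}" "S = (!) vs ` R" by (meson subset_imageE)
    then show "\<exists>S\<subseteq>{..<n'}. k \<le> excess F' S" using excess S(2) by auto
  qed
  then show "HS_yes {..<n'} F' k \<longleftrightarrow> (\<exists>S\<subseteq>K. k \<le> excess F S)"
    using HS_yes_iff_excess[OF hyp] by simp
qed

definition kernel :: "nat \<Rightarrow> nat set list \<Rightarrow> int \<Rightarrow> instance_HS" where
  "kernel n F k = (if k \<le> excess F (greedy F n) then (1, [], 0)
     else (case induced n F (keep F k (hits F (greedy F n)) n) of (n', F') \<Rightarrow> (n', F', k)))"

lemma keep_nonempty:
  assumes "0 < n" "0 \<le> k"
  shows "keep F k B n \<noteq> {}"
proof -
  have "0 \<in> keep F k B (Suc 0)" using assms(2) by simp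
  then show ?thesis using keep_mono[of "Suc 0" n F k B] assms(1) by auto
qed

lemma kernel_bounds:
  fixes k b h p :: nat
  assumes "1 \<le> k" "b \<le> 2 * (k - 1)" "h \<le> b + p" "p \<le> 2 ^ b * (k + 1)"
  shows "p \<le> k * 4 ^ k" "h \<le> k * 4 ^ k"
proof -
  have "(2::nat) ^ b \<le> 2 ^ (2 * (k - 1))" using assms(2) by (intro power_increasing) auto
  also have "\<dots> = 4 ^ (k - 1)" by (simp add: power_mult)
  finally have "p \<le> 4 ^ (k - 1) * (k + 1)" using assms(4) by (meson le_trans mult_le_mono1)
  also have "\<dots> \<le> 4 ^ (k - 1) * (2 * k)" using assms(1) by (intro mult_left_mono) auto
  finally have p: "p \<le> 2 * (k * 4 ^ (k - 1))" by (simp add: ac_simps)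
  have k: "k * 4 ^ k = 4 * (k * 4 ^ (k - 1))"
    using assms(1) power_Suc[of "4::nat" "k - 1"] by simp
  show "p \<le> k * 4 ^ k" using p k by linarith
  have "k * 1 \<le> k * 4 ^ (k - 1)" by (intro mult_left_mono) auto
  then show "h \<le> k * 4 ^ k" using p k assms(2,3) by linarith
qed

lemma kernel_correct:
  assumes "hypergraph {..<n} F" "kernel n F k = (n', F', k')"
  shows "hypergraph {..<n'} F'" "HS_yes {..<n'} F' k' \<longleftrightarrow> HS_yes {..<n} F k"
    "\<bar>k'\<bar> \<le> \<bar>k\<bar>" "n' \<le> max 1 (nat k * 4 ^ nat k)" "length F' \<le> nat k * 4 ^ nat k"
proof -
  let ?C = "greedy F n"
  let ?B = "hits F ?C"
  let ?K = "keep F k ?B n"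
  have goal: "hypergraph {..<n'} F' \<and> (HS_yes {..<n'} F' k' \<longleftrightarrow> HS_yes {..<n} F k) \<and>
    \<bar>k'\<bar> \<le> \<bar>k\<bar> \<and> n' \<le> max 1 (nat k * 4 ^ nat k) \<and> length F' \<le> nat k * 4 ^ nat k"
  proof (cases "k \<le> excess F ?C")
    case True
    then have "HS_yes {..<n} F k"
      using HS_yes_iff_excess[OF assms(1)] greedy_subset by blast
    moreover have "n' = 1" "F' = []" "k' = 0" using True assms(2) by (auto simp: kernel_def)
    moreover have "HS_yes {..<1} ([] :: nat set list) 0"
      by (auto simp: HS_yes_def hitting_set_def intro!: exI[of _ "{}"])
    ultimately show ?thesis by (auto simp: hypergraph_def)
  next
    case False
    have k: "1 \<le> k" using False card_greedy[of F n] by (simp add: excess_def)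
    have ind: "induced n F ?K = (n', F')" "k' = k"
      using False assms(2) by (auto simp: kernel_def split: prod.splits)
    have "0 < n" using assms(1) by (auto simp: hypergraph_def)
    then have K: "?K \<subseteq> {..<n}" "?K \<noteq> {}" using keep_subset keep_nonempty k by auto
    note ind' = induced_correct[OF K ind(1)]
    have one: "card (hits F {u} - ?B) \<le> 1" if "u < n" for u
      by (rule card_outside_greedy[OF that])
    have "(\<exists>S\<subseteq>?K. k \<le> excess F S) \<longleftrightarrow> (\<exists>S\<subseteq>{..<n}. k \<le> excess F S)"
      using excess_in_keep[OF one finite_hits] k K(1) by (meson order_trans zero_le_one)
    then have yes: "HS_yes {..<n'} F' k \<longleftrightarrow> HS_yes {..<n} F k"
      using ind'(4) HS_yes_iff_excess[OF assms(1)] by simp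
    have b: "card ?B \<le> 2 * (nat k - 1)"
      using False card_greedy[of F n] k by (simp add: excess_def)
    have p: "card ?K \<le> 2 ^ card ?B * (nat k + 1)"
      using card_keep[of k ?B F n] k by (simp add: nat_add_distrib)
    have "hits F ?K \<subseteq> ?B \<union> (\<Union>u\<in>?K. hits F {u} - ?B)" using hits_UN[of F ?K] by auto
    then have "card (hits F ?K) \<le> card (?B \<union> (\<Union>u\<in>?K. hits F {u} - ?B))"
      by (intro card_mono) auto
    also have "\<dots> \<le> card ?B + card (\<Union>u\<in>?K. hits F {u} - ?B)" by (rule card_Un_le)
    also have "card (\<Union>u\<in>?K. hits F {u} - ?B) \<le> (\<Sum>u\<in>?K. card (hits F {u} - ?B))"
      by (rule card_UN_le) simp
    also have "\<dots> \<le> (\<Sum>u\<in>?K. 1)" using one K(1) by (intro sum_mono) auto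
    finally have h: "card (hits F ?K) \<le> card ?B + card ?K" by simp
    have "1 \<le> nat k" using k by simp
    note kernel_bounds[OF this b h p]
    then show ?thesis using ind' yes ind(2) by auto
  qed
  then show "hypergraph {..<n'} F'" "HS_yes {..<n'} F' k' \<longleftrightarrow> HS_yes {..<n} F k"
    "\<bar>k'\<bar> \<le> \<bar>k\<bar>" "n' \<le> max 1 (nat k * 4 ^ nat k)" "length F' \<le> nat k * 4 ^ nat k"
    by blast+
qed


section \<open>A loop language for the machine\<close>

datatype com =
    Skip
  | Set nat int
  | Plus nat nat nat
  | Minus nat nat nat
  | Get nat nat nat
  | Put nat nat nat
  | Input nat
  | Output nat
  | Seq com com (infixr \<open>;;\<close> 60)
  | IfPos nat com com
  | For nat nat com

record state =
  reg :: "nat \<Rightarrow> int"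
  arr :: "nat \<Rightarrow> nat \<Rightarrow> int"
  inp :: "int list"
  out :: "int list"

definition upd :: "nat \<Rightarrow> int \<Rightarrow> state \<Rightarrow> state" where
  "upd x c s = s\<lparr>reg := (reg s)(x := c)\<rparr>"

lemma upd_simps [simp]:
  "reg (upd x c s) = (reg s)(x := c)" "arr (upd x c s) = arr s"
  "inp (upd x c s) = inp s" "out (upd x c s) = out s"
  by (simp_all add: upd_def)

primrec sem :: "com \<Rightarrow> state \<Rightarrow> state" where
  "sem Skip = (\<lambda>s. s)"
| "sem (Set x c) = upd x c"
| "sem (Plus x y z) = (\<lambda>s. upd x (reg s y + reg s z) s)"
| "sem (Minus x y z) = (\<lambda>s. upd x (reg s y - reg s z) s)"
| "sem (Get x a i) = (\<lambda>s. upd x (arr s a (nat (reg s i))) s)"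
| "sem (Put a i x) =
     (\<lambda>s. s\<lparr>arr := (arr s)(a := (arr s a)(nat (reg s i) := reg s x))\<rparr>)"
| "sem (Input x) = (\<lambda>s. upd x (case inp s of [] \<Rightarrow> 0 | y # _ \<Rightarrow> y) (s\<lparr>inp := tl (inp s)\<rparr>))"
| "sem (Output x) = (\<lambda>s. s\<lparr>out := out s @ [reg s x]\<rparr>)"
| "sem (c ;; d) = (\<lambda>s. sem d (sem c s))"
| "sem (IfPos x c d) = (\<lambda>s. if reg s x > 0 then sem c s else sem d s)"
| "sem (For i b c) = (\<lambda>s. upd i (int (nat (reg s b)))
     (fold (\<lambda>j s. sem c (upd i (int j) s)) [0..<nat (reg s b)] s))"

primrec writes :: "com \<Rightarrow> nat set" where
  "writes Skip = {}"
| "writes (Set x c) = {x}"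
| "writes (Plus x y z) = {x}"
| "writes (Minus x y z) = {x}"
| "writes (Get x a i) = {x}"
| "writes (Put a i x) = {}"
| "writes (Input x) = {x}"
| "writes (Output x) = {}"
| "writes (c ;; d) = writes c \<union> writes d"
| "writes (IfPos x c d) = writes c \<union> writes d"
| "writes (For i b c) = insert i (writes c)"

primrec puts :: "com \<Rightarrow> nat set" where
  "puts Skip = {}"
| "puts (Set x c) = {}"
| "puts (Plus x y z) = {}"
| "puts (Minus x y z) = {}"
| "puts (Get x a i) = {}"
| "puts (Put a i x) = {a}"
| "puts (Input x) = {}"
| "puts (Output x) = {}"
| "puts (c ;; d) = puts c \<union> puts d"
| "puts (IfPos x c d) = puts c \<union> puts d"
| "puts (For i b c) = puts c"

primrec silent :: "com \<Rightarrow> bool" where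
  "silent Skip = True"
| "silent (Set x c) = True"
| "silent (Plus x y z) = True"
| "silent (Minus x y z) = True"
| "silent (Get x a i) = True"
| "silent (Put a i x) = True"
| "silent (Input x) = True"
| "silent (Output x) = False"
| "silent (c ;; d) = (silent c \<and> silent d)"
| "silent (IfPos x c d) = (silent c \<and> silent d)"
| "silent (For i b c) = silent c"

lemma fold_invariant_upt:
  assumes "P 0 s" "\<And>j s. j < n \<Longrightarrow> P j s \<Longrightarrow> P (Suc j) (f j s)"
  shows "P n (fold f [0..<n] s)"
  using assms by (induction n) auto

lemma reg_sem: "x \<notin> writes c \<Longrightarrow> reg (sem c s) x = reg s x"
proof (induction c arbitrary: s)
  case (For i b c)
  have "reg (fold (\<lambda>j s. sem c (upd i (int j) s)) [0..<n] s) x = reg s x" for n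
    by (rule fold_invariant_upt[where P = "\<lambda>_ s'. reg s' x = reg s x"]) (use For in auto)
  then show ?case using For.prems by auto
qed auto

lemma arr_sem: "a \<notin> puts c \<Longrightarrow> arr (sem c s) a = arr s a"
proof (induction c arbitrary: s)
  case (For i b c)
  have "arr (fold (\<lambda>j s. sem c (upd i (int j) s)) [0..<n] s) a = arr s a" for n
    by (rule fold_invariant_upt[where P = "\<lambda>_ s'. arr s' a = arr s a"]) (use For in auto)
  then show ?case by auto
qed auto

lemma out_sem: "silent c \<Longrightarrow> out (sem c s) = out s"
proof (induction c arbitrary: s)
  case (For i b c)
  have "out (fold (\<lambda>j s. sem c (upd i (int j) s)) [0..<n] s) = out s" for n
    by (rule fold_invariant_upt[where P = "\<lambda>_ s'. out s' = out s"]) (use For in auto)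
  then show ?case by auto
qed auto


section \<open>Compilation\<close>

text \<open>
  Registers 0 and 1 are scratch registers, registers 2 to 63 hold the program variables and
  cell \<open>i\<close> of array \<open>a < 4\<close> is register \<open>64 + 4i + a\<close>.
\<close>

definition address :: "nat \<Rightarrow> nat \<Rightarrow> instr list" where
  "address base i = [Const 0 0, JumpPos i (base + 3), Sub 0 0 i, Add 0 0 i,
     Add 0 0 0, Add 0 0 0]"

primrec code_length :: "com \<Rightarrow> nat" where
  "code_length Skip = 0"
| "code_length (Set x c) = 1"
| "code_length (Plus x y z) = 1"
| "code_length (Minus x y z) = 1"
| "code_length (Get x a i) = 9"
| "code_length (Put a i x) = 9"
| "code_length (Input x) = 1"
| "code_length (Output x) = 1"
| "code_length (c ;; d) = code_length c + code_length d"
| "code_length (IfPos x c d) = code_length c + code_length d + 3"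
| "code_length (For i b c) = code_length c + 7"

primrec compile :: "com \<Rightarrow> nat \<Rightarrow> instr list" where
  "compile Skip = (\<lambda>base. [])"
| "compile (Set x c) = (\<lambda>base. [Const x c])"
| "compile (Plus x y z) = (\<lambda>base. [Add x y z])"
| "compile (Minus x y z) = (\<lambda>base. [Sub x y z])"
| "compile (Get x a i) = (\<lambda>base. address base i @ [Const 1 (int (64 + a)), Add 0 0 1, Load x 0])"
| "compile (Put a i x) = (\<lambda>base. address base i @ [Const 1 (int (64 + a)), Add 0 0 1, Store 0 x])"
| "compile (Input x) = (\<lambda>base. [Read x])"
| "compile (Output x) = (\<lambda>base. [Write x])"
| "compile (c ;; d) = (\<lambda>base. compile c base @ compile d (base + code_length c))"
| "compile (IfPos x c d) = (\<lambda>base.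
     [JumpPos x (base + 3 + code_length d)] @ compile d (base + 1) @
     [Const 0 1, JumpPos 0 (base + 3 + code_length d + code_length c)] @
     compile c (base + 3 + code_length d))"
| "compile (For i b c) = (\<lambda>base.
     [Const i 0, Const 0 1, JumpPos 0 (base + 5 + code_length c)] @ compile c (base + 3) @
     [Const 0 1, Add i i 0, Sub 0 b i, JumpPos 0 (base + 3)])"

lemma length_compile [simp]: "length (compile c base) = code_length c"
  by (induction c arbitrary: base) (auto simp: address_def)

definition var :: "nat \<Rightarrow> bool" where
  "var x \<longleftrightarrow> 2 \<le> x \<and> x < 64"

text \<open>
  The registers in \<open>B\<close>, which contain the bounds of all loops, are never written.  So if they are
  at most \<open>N\<close> initially, then the syntax alone bounds the running time by a polynomial in \<open>N\<close>.
\<close>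

primrec ok :: "nat set \<Rightarrow> com \<Rightarrow> bool" where
  "ok B Skip = True"
| "ok B (Set x c) = (var x \<and> x \<notin> B)"
| "ok B (Plus x y z) = (var x \<and> var y \<and> var z \<and> x \<notin> B)"
| "ok B (Minus x y z) = (var x \<and> var y \<and> var z \<and> x \<notin> B)"
| "ok B (Get x a i) = (var x \<and> a < 4 \<and> var i \<and> x \<notin> B)"
| "ok B (Put a i x) = (a < 4 \<and> var i \<and> var x)"
| "ok B (Input x) = (var x \<and> x \<notin> B)"
| "ok B (Output x) = var x"
| "ok B (c ;; d) = (ok B c \<and> ok B d)"
| "ok B (IfPos x c d) = (var x \<and> ok B c \<and> ok B d)"
| "ok B (For i b c) = (var i \<and> var b \<and> i \<notin> B \<and> b \<in> B \<and> i \<notin> writes c \<and> ok B c)"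

primrec cost :: "nat \<Rightarrow> com \<Rightarrow> nat" where
  "cost N Skip = 0"
| "cost N (Set x c) = 1"
| "cost N (Plus x y z) = 1"
| "cost N (Minus x y z) = 1"
| "cost N (Get x a i) = 9"
| "cost N (Put a i x) = 9"
| "cost N (Input x) = 1"
| "cost N (Output x) = 1"
| "cost N (c ;; d) = cost N c + cost N d"
| "cost N (IfPos x c d) = 3 + cost N c + cost N d"
| "cost N (For i b c) = 5 + N * (cost N c + 4)"

lemma cost_polynomial: "\<exists>C d. \<forall>N\<ge>1. cost N c \<le> C * N ^ d"
proof (induction c)
  case (Seq c1 c2)
  then obtain C1 d1 C2 d2 where
    1: "\<forall>N\<ge>1. cost N c1 \<le> C1 * N ^ d1" and 2: "\<forall>N\<ge>1. cost N c2 \<le> C2 * N ^ d2" by blast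
  have "cost N (c1 ;; c2) \<le> (C1 + C2) * N ^ (d1 + d2)" if "N \<ge> 1" for N
  proof -
    have "C1 * N ^ d1 \<le> C1 * N ^ (d1 + d2)" "C2 * N ^ d2 \<le> C2 * N ^ (d1 + d2)"
      using that by (auto intro!: mult_left_mono power_increasing)
    moreover have "cost N c1 \<le> C1 * N ^ d1" "cost N c2 \<le> C2 * N ^ d2" using 1 2 that by auto
    ultimately show ?thesis unfolding cost.simps add_mult_distrib by linarith
  qed
  then show ?case by blast
next
  case (IfPos x c1 c2)
  then obtain C1 d1 C2 d2 where
    1: "\<forall>N\<ge>1. cost N c1 \<le> C1 * N ^ d1" and 2: "\<forall>N\<ge>1. cost N c2 \<le> C2 * N ^ d2" by blast
  have "cost N (IfPos x c1 c2) \<le> (3 + C1 + C2) * N ^ (d1 + d2)" if "N \<ge> 1" for N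
  proof -
    have "C1 * N ^ d1 \<le> C1 * N ^ (d1 + d2)" "C2 * N ^ d2 \<le> C2 * N ^ (d1 + d2)"
      "1 \<le> N ^ (d1 + d2)"
      using that by (auto intro!: mult_left_mono power_increasing)
    moreover have "cost N c1 \<le> C1 * N ^ d1" "cost N c2 \<le> C2 * N ^ d2" using 1 2 that by auto
    ultimately show ?thesis unfolding cost.simps add_mult_distrib by linarith
  qed
  then show ?case by blast
next
  case (For i b c)
  then obtain C d where 1: "\<forall>N\<ge>1. cost N c \<le> C * N ^ d" by blast
  have "cost N (For i b c) \<le> (9 + C) * N ^ Suc d" if "N \<ge> 1" for N
  proof -
    have "N * cost N c \<le> N * (C * N ^ d)" using 1 that by auto
    moreover have "1 * N \<le> N ^ d * N" using that by (intro mult_right_mono) auto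
    moreover have "(9 + C) * N ^ Suc d = 9 * (N ^ d * N) + N * (C * N ^ d)"
      by (simp add: algebra_simps)
    ultimately show ?thesis using that unfolding cost.simps distrib_left by linarith
  qed
  then show ?case by blast
qed (rule exI[of _ 9], rule exI[of _ 0], simp)+

definition code_at :: "instr list \<Rightarrow> nat \<Rightarrow> instr list \<Rightarrow> bool" where
  "code_at P base Q \<longleftrightarrow> base + length Q \<le> length P \<and> (\<forall>i<length Q. P ! (base + i) = Q ! i)"

lemma all_less_add:
  fixes a b :: nat
  shows "(\<forall>i<a + b. Q i) \<longleftrightarrow> (\<forall>i<a. Q i) \<and> (\<forall>i<b. Q (a + i))"
  by (metis le_Suc_ex nat_add_left_cancel_less not_le trans_less_add1)

lemma code_at_append [simp]:
  "code_at P base (Q @ R) \<longleftrightarrow> code_at P base Q \<and> code_at P (base + length Q) R"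
  by (auto simp: code_at_def all_less_add nth_append add.assoc)

lemma code_at_Cons [simp]:
  "code_at P base (i # R) \<longleftrightarrow> base < length P \<and> P ! base = i \<and> code_at P (Suc base) R"
  by (auto simp: code_at_def All_less_Suc2)

lemma code_at_Nil [simp]: "code_at P base [] \<longleftrightarrow> base \<le> length P"
  by (simp add: code_at_def)

definition represents :: "(nat \<Rightarrow> int) \<Rightarrow> state \<Rightarrow> bool" where
  "represents X s \<longleftrightarrow> (\<forall>x. var x \<longrightarrow> X x = reg s x) \<and>
     (\<forall>a i. a < 4 \<longrightarrow> X (64 + 4 * i + a) = arr s a i)"

definition sim :: "instr list \<Rightarrow> nat \<Rightarrow> state \<Rightarrow> nat \<Rightarrow> nat \<Rightarrow> state \<Rightarrow> bool" where
  "sim P pc s T pc' s' \<longleftrightarrow> (\<forall>X. represents X s \<longrightarrow>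
     (\<exists>t\<le>T. \<exists>X'. (step P ^^ t) (pc, X, inp s, out s) = (pc', X', inp s', out s') \<and>
        represents X' s'))"

lemma sim_refl: "sim P pc s 0 pc s"
  by (auto simp: sim_def)

lemma sim_trans:
  assumes "sim P pc s T pc' s'" "sim P pc' s' T' pc'' s''"
  shows "sim P pc s (T + T') pc'' s''"
  unfolding sim_def
proof (intro allI impI)
  fix X assume "represents X s"
  from assms(1)[unfolded sim_def, rule_format, OF this]
  obtain t X' where 1: "t \<le> T" "represents X' s'"
    "(step P ^^ t) (pc, X, inp s, out s) = (pc', X', inp s', out s')" by blast
  from assms(2)[unfolded sim_def, rule_format, OF 1(2)]
  obtain t' X'' where 2: "t' \<le> T'" "represents X'' s''"
    "(step P ^^ t') (pc', X', inp s', out s') = (pc'', X'', inp s'', out s'')" by blast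
  have "(step P ^^ (t' + t)) (pc, X, inp s, out s) = (pc'', X'', inp s'', out s'')"
    using 1(3) 2(3) by (simp add: funpow_add)
  moreover have "t' + t \<le> T + T'" using 1(1) 2(1) by simp
  ultimately show "\<exists>t\<le>T + T'. \<exists>X'. (step P ^^ t) (pc, X, inp s, out s) =
      (pc'', X', inp s'', out s'') \<and> represents X' s''"
    using 2(2) by blast
qed

lemma sim_mono:
  assumes "sim P pc s T pc' s'" "T \<le> T'"
  shows "sim P pc s T' pc' s'"
  using assms(1) order_trans[OF _ assms(2)] unfolding sim_def by fast

lemma simI:
  assumes "\<And>X. represents X s \<Longrightarrow> (\<And>x. var x \<Longrightarrow> X x = reg s x) \<Longrightarrow>
    \<exists>X'. (step P ^^ t) (pc, X, inp s, out s) = (pc', X', inp s', out s') \<and> represents X' s'"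
  shows "sim P pc s t pc' s'"
  unfolding sim_def
proof (intro allI impI)
  fix X assume "represents X s"
  from assms[OF this] this show "\<exists>t'\<le>t. \<exists>X'.
      (step P ^^ t') (pc, X, inp s, out s) = (pc', X', inp s', out s') \<and> represents X' s'"
    unfolding represents_def by blast
qed

lemma representsD:
  assumes "represents X s"
  shows "var x \<Longrightarrow> X x = reg s x" "a < 4 \<Longrightarrow> X (64 + 4 * i + a) = arr s a i"
  using assms by (auto simp: represents_def)

lemma represents_scratch [simp]:
  "represents X s \<Longrightarrow> represents (X(0 := c)) s"
  "represents X s \<Longrightarrow> represents (X(Suc 0 := c)) s"
  by (auto simp: represents_def var_def)

lemma represents_upd [simp]:
  "represents X s \<Longrightarrow> var x \<Longrightarrow> represents (X(x := c)) (upd x c s)"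
  by (auto simp: represents_def var_def)

lemma represents_inp_out [simp]:
  "represents X (s\<lparr>inp := xs\<rparr>) = represents X s"
  "represents X (s\<lparr>out := xs\<rparr>) = represents X s"
  by (auto simp: represents_def)

lemma represents_put [simp]:
  assumes "represents X s" "a < 4"
  shows "represents (X(64 + 4 * i + a := c)) (s\<lparr>arr := (arr s)(a := (arr s a)(i := c))\<rparr>)"
proof -
  have "64 + 4 * i' + a' = 64 + 4 * i + a \<longleftrightarrow> i' = i \<and> a' = a" if "a' < 4" for a' i'
    using that assms(2) by presburger
  then show ?thesis using assms unfolding represents_def var_def by auto
qed

lemma scratch_not_var [simp]: "\<not> var 0" "\<not> var (Suc 0)"
  by (auto simp: var_def)

lemma step_numeral [simp]: "(step P ^^ numeral k) c = step P ((step P ^^ pred_numeral k) c)"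
  by (simp add: numeral_eq_Suc)

lemma sim_simple:
  assumes "base < length P" "P ! base = i"
    and "\<And>X. represents X s \<Longrightarrow> (\<And>x. var x \<Longrightarrow> X x = reg s x) \<Longrightarrow>
      \<exists>X'. exec i (base, X, inp s, out s) = (pc', X', inp s', out s') \<and> represents X' s'"
  shows "sim P base s 1 pc' s'"
  using assms by (intro simI) (simp add: step_def)

lemma sim_goto:
  assumes "code_at P base [Const 0 1, JumpPos 0 l]"
  shows "sim P base s 2 l s"
  using assms by (intro simI) (auto simp: step_def)

lemma add_numeral_Suc:
  "n + 3 = Suc (Suc (Suc n))" "n + 8 = Suc (Suc (Suc (Suc (Suc (Suc (Suc (Suc n)))))))"
  by simp_all

lemma steps_address:
  assumes "code_at P base (address base i @ [Const 1 (int (64 + a)), Add 0 0 1])"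
    and "represents X s" "var i"
  shows "\<exists>t\<le>8. \<exists>X'. (step P ^^ t) (base, X, xs, ys) = (base + 8, X', xs, ys) \<and>
    represents X' s \<and> X' 0 = int (64 + 4 * nat (reg s i) + a)"
proof -
  have i: "i \<noteq> 0" "i \<noteq> Suc 0" "X i = reg s i"
    using assms(2,3) by (auto simp: represents_def var_def)
  note A = assms(1)[unfolded address_def, simplified]
  show ?thesis
  proof (cases "reg s i > 0")
    case True
    then show ?thesis using A i assms(2)
      by (intro exI[of _ 7]) (auto simp: step_def add_numeral_Suc)
  next
    case False
    then show ?thesis using A i assms(2)
      by (intro exI[of _ 8]) (auto simp: step_def add_numeral_Suc)
  qed
qed

lemma sim_access:
  assumes "code_at P base (address base i @ [Const 1 (int (64 + a)), Add 0 0 1, j])" "var i"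
    and "\<And>X. represents X s \<Longrightarrow> X 0 = int (64 + 4 * nat (reg s i) + a) \<Longrightarrow>
      (\<And>x. var x \<Longrightarrow> X x = reg s x) \<Longrightarrow>
      (\<And>a j. a < 4 \<Longrightarrow> X (64 + 4 * j + a) = arr s a j) \<Longrightarrow>
      \<exists>X'. exec j (base + 8, X, inp s, out s) = (base + 9, X', inp s', out s') \<and> represents X' s'"
  shows "sim P base s 9 (base + 9) s'"
  unfolding sim_def
proof (intro allI impI)
  fix X assume X: "represents X s"
  have code: "code_at P base (address base i @ [Const 1 (int (64 + a)), Add 0 0 1])"
    "base + 8 < length P" "P ! (base + 8) = j"
    using assms(1) by (simp_all add: address_def add_numeral_Suc)
  obtain t X' where t: "t \<le> 8" "represents X' s" "X' 0 = int (64 + 4 * nat (reg s i) + a)"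
    "(step P ^^ t) (base, X, inp s, out s) = (base + 8, X', inp s, out s)"
    using steps_address[OF code(1) X assms(2)] by blast
  obtain X'' where X'': "represents X'' s'"
    "exec j (base + 8, X', inp s, out s) = (base + 9, X'', inp s', out s')"
    using assms(3)[OF t(2,3) representsD[OF t(2)]] by blast
  have "(step P ^^ Suc t) (base, X, inp s, out s) = (base + 9, X'', inp s', out s')"
    using t(4) X''(2) code(2,3) by (simp add: step_def)
  then show "\<exists>t\<le>9. \<exists>X'. (step P ^^ t) (base, X, inp s, out s) = (base + 9, X', inp s', out s') \<and>
      represents X' s'"
    using t(1) X''(1) by (intro exI[of _ "Suc t"]) auto
qed

lemma ok_not_writes: "ok B c \<Longrightarrow> b \<in> B \<Longrightarrow> b \<notin> writes c"
  by (induction c) auto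

lemma sim_compile:
  assumes "ok B c" "code_at P base (compile c base)" "\<forall>b\<in>B. reg s b \<le> int N"
  shows "sim P base s (cost N c) (base + code_length c) (sem c s)"
  using assms
proof (induction c arbitrary: base s)
  case Skip
  then show ?case by (simp add: sim_refl)
next
  case (Set x c)
  then show ?case unfolding cost.simps code_length.simps
    by (intro sim_simple[where i = "Const x c"]) auto
next
  case (Plus x y z)
  then show ?case unfolding cost.simps code_length.simps
    by (intro sim_simple[where i = "Add x y z"]) auto
next
  case (Minus x y z)
  then show ?case unfolding cost.simps code_length.simps
    by (intro sim_simple[where i = "Sub x y z"]) auto
next
  case (Get x a i)
  show ?case unfolding cost.simps code_length.simps
  proof (rule sim_access)
    show "code_at P base (address base i @ [Const 1 (int (64 + a)), Add 0 0 1, Load x 0])"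
      using Get.prems(2) by simp
  qed (use Get.prems in \<open>auto simp: nat_add_distrib nat_mult_distrib\<close>)
next
  case (Put a i x)
  show ?case unfolding cost.simps code_length.simps
  proof (rule sim_access)
    show "code_at P base (address base i @ [Const 1 (int (64 + a)), Add 0 0 1, Store 0 x])"
      using Put.prems(2) by simp
  qed (use Put.prems in \<open>auto simp: nat_add_distrib nat_mult_distrib
    represents_put[where i = 0, simplified]\<close>)
next
  case (Input x)
  then show ?case unfolding cost.simps code_length.simps
    by (intro sim_simple[where i = "Read x"]) auto
next
  case (Output x)
  then show ?case unfolding cost.simps code_length.simps
    by (intro sim_simple[where i = "Write x"]) auto
next
  case (Seq c d)
  have "sim P base s (cost N c) (base + code_length c) (sem c s)"
    using Seq.prems by (intro Seq.IH(1)) auto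
  moreover have "sim P (base + code_length c) (sem c s) (cost N d)
      (base + code_length c + code_length d) (sem d (sem c s))"
    using Seq.prems by (intro Seq.IH(2)) (auto simp: reg_sem ok_not_writes)
  ultimately show ?case using sim_trans by (simp add: add.assoc)
next
  case (IfPos x c d)
  let ?then = "base + 3 + code_length d" and ?end = "base + 3 + code_length d + code_length c"
  have code: "base < length P" "P ! base = JumpPos x ?then"
    "code_at P (base + 1) (compile d (base + 1))"
    "code_at P (base + 1 + code_length d) [Const 0 1, JumpPos 0 ?end]"
    "code_at P ?then (compile c ?then)"
    using IfPos.prems(2) by (simp_all add: eval_nat_numeral)
  show ?case
  proof (cases "reg s x > 0")
    case True
    have "sim P base s 1 ?then s"
      using True IfPos.prems(1) by (intro sim_simple[OF code(1,2)]) auto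
    moreover have "sim P ?then s (cost N c) ?end (sem c s)"
      using IfPos.prems code by (intro IfPos.IH(1)) auto
    ultimately have "sim P base s (1 + cost N c) ?end (sem c s)"
      by (rule sim_trans)
    then show ?thesis using True by (auto elim!: sim_mono simp: ac_simps)
  next
    case False
    have "sim P base s 1 (base + 1) s"
      using False IfPos.prems(1) by (intro sim_simple[OF code(1,2)]) auto
    moreover have "sim P (base + 1) s (cost N d) (base + 1 + code_length d) (sem d s)"
      using IfPos.prems code by (intro IfPos.IH(2)) auto
    ultimately have "sim P base s (1 + cost N d) (base + 1 + code_length d) (sem d s)"
      by (rule sim_trans)
    from sim_trans[OF this sim_goto[OF code(4)]] show ?thesis
      using False by (auto elim!: sim_mono simp: ac_simps)
  qed
next
  case (For i b c)
  let ?test = "base + 5 + code_length c"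
  have code: "base < length P" "P ! base = Const i 0"
    "code_at P (base + 1) [Const 0 1, JumpPos 0 ?test]"
    "code_at P (base + 3) (compile c (base + 3))"
    "code_at P (base + 3 + code_length c) [Const 0 1, Add i i 0]"
    "code_at P ?test [Sub 0 b i, JumpPos 0 (base + 3)]"
    using For.prems(2) by (simp_all add: eval_nat_numeral)
  have ok: "var i" "var b" "i \<noteq> b" "i \<notin> writes c" "b \<notin> writes c" "b \<in> B" "i \<notin> B" "ok B c"
    using For.prems(1) ok_not_writes by auto
  define n where "n = nat (reg s b)"
  define loop where "loop j = fold (\<lambda>j s. sem c (upd i (int j) s)) [0..<j] s" for j
  have loop_Suc: "loop (Suc j) = sem c (upd i (int j) (loop j))" for j
    by (simp add: loop_def)
  have reg_loop: "reg (loop j) x = reg s x" if "x \<in> B" for j x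
    using that ok For.prems(1)
    by (induction j) (auto simp: loop_Suc reg_sem ok_not_writes loop_def)
  have test: "sim P ?test s' 2 (if reg s' i < reg s' b then base + 3 else ?test + 2) s'" for s'
    using code(6) ok by (intro simI) (auto simp: step_def)
  have incr: "sim P (base + 3 + code_length c) s' 2 ?test (upd i (reg s' i + 1) s')" for s'
    using code(5) ok by (intro simI) (auto simp: step_def)
  have "sim P base s 1 (base + 1) (upd i 0 s)"
    using ok by (intro sim_simple[OF code(1,2)]) auto
  from sim_trans[OF this sim_goto[OF code(3)]]
  have start: "sim P base s 3 ?test (upd i 0 s)"
    by (simp add: numeral_3_eq_3)
  have iter: "sim P base s (3 + j * (cost N c + 4)) ?test (upd i (int j) (loop j))" if "j \<le> n" for j
    using that
  proof (induction j)
    case 0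
    then show ?case using start by (simp add: loop_def)
  next
    case (Suc j)
    let ?s = "upd i (int j) (loop j)"
    have "reg ?s i < reg ?s b" using Suc.prems ok reg_loop by (auto simp: n_def)
    then have "sim P ?test ?s 2 (base + 3) ?s" using test[of ?s] by simp
    moreover have "sim P (base + 3) ?s (cost N c) (base + 3 + code_length c) (sem c ?s)"
      using For.prems code ok reg_loop by (intro For.IH) auto
    ultimately have "sim P ?test ?s (2 + cost N c) (base + 3 + code_length c) (sem c ?s)"
      by (rule sim_trans)
    moreover have "reg (sem c ?s) i = int j" using ok by (simp add: reg_sem)
    then have "sim P (base + 3 + code_length c) (sem c ?s) 2 ?test (upd i (int (Suc j)) (loop (Suc j)))"
      using incr[of "sem c ?s"] by (simp add: loop_Suc add.commute)
    ultimately have "sim P ?test ?s (2 + cost N c + 2) ?test (upd i (int (Suc j)) (loop (Suc j)))"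
      by (rule sim_trans)
    from sim_trans[OF Suc.IH this] Suc.prems
    have "sim P base s (3 + j * (cost N c + 4) + (2 + cost N c + 2)) ?test
        (upd i (int (Suc j)) (loop (Suc j)))"
      by simp
    then show ?case by (simp add: algebra_simps)
  qed
  have "n \<le> N" using For.prems(3) ok by (auto simp: n_def)
  have sem: "sem (For i b c) s = upd i (int n) (loop n)"
    by (simp add: n_def loop_def)
  have "\<not> int n < reg (loop n) b" using reg_loop ok by (auto simp: n_def)
  then have "sim P ?test (upd i (int n) (loop n)) 2 (?test + 2) (upd i (int n) (loop n))"
    using test[of "upd i (int n) (loop n)"] ok by simp
  from sim_trans[OF iter[OF order_refl] this]
  have "sim P base s (5 + n * (cost N c + 4)) (?test + 2) (sem (For i b c) s)"
    unfolding sem by (simp add: ac_simps)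
  moreover have "5 + n * (cost N c + 4) \<le> cost N (For i b c)"
    using \<open>n \<le> N\<close> by simp
  ultimately show ?case by (auto elim!: sim_mono simp: ac_simps simp del: sem.simps)
qed

definition initial :: "int list \<Rightarrow> state" where
  "initial xs = \<lparr>reg = (\<lambda>_. 0), arr = (\<lambda>_ _. 0), inp = xs, out = []\<rparr>"

lemma computes_within_compile:
  assumes "ok {} c" "ok B d" "cost 0 c + cost N d \<le> t"
    and "\<forall>b\<in>B. reg (sem c (initial xs)) b \<le> int N"
  shows "computes_within (compile (c ;; d) 0) xs (out (sem (c ;; d) (initial xs))) t"
proof -
  let ?P = "compile (c ;; d) 0"
  have code: "code_at ?P 0 (compile c 0)" "code_at ?P (code_length c) (compile d (code_length c))"
    by (auto simp: code_at_def nth_append)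
  have 1: "sim ?P 0 (initial xs) (cost 0 c) (code_length c) (sem c (initial xs))"
    using sim_compile[OF assms(1) code(1)] by simp
  have 2: "sim ?P (code_length c) (sem c (initial xs)) (cost N d) (length ?P) (sem (c ;; d) (initial xs))"
    using sim_compile[OF assms(2) code(2) assms(4)] by simp
  have "represents (\<lambda>_. 0) (initial xs)" by (simp add: represents_def initial_def)
  moreover have "inp (initial xs) = xs" "out (initial xs) = []" by (simp_all add: initial_def)
  ultimately obtain t' X zs where t': "t' \<le> t"
    "(step ?P ^^ t') (0, \<lambda>_. 0, xs, []) = (length ?P, X, zs, out (sem (c ;; d) (initial xs)))"
    using sim_mono[OF sim_trans[OF 1 2] assms(3)] unfolding sim_def by metis
  have halt: "(step ?P ^^ r) (length ?P, X, zs, ys) = (length ?P, X, zs, ys)" for r ys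
    by (induction r) (auto simp: step_def)
  have "t = (t - t') + t'" using t'(1) by simp
  then have "(step ?P ^^ t) (0, \<lambda>_. 0, xs, []) =
      (length ?P, X, zs, out (sem (c ;; d) (initial xs)))"
    using t'(2) halt by (metis comp_apply funpow_add)
  then show ?thesis unfolding computes_within_def by blast
qed


section \<open>The program\<close>

declare sem.simps(11) [simp del]

lemma upd_upd [simp]: "upd x c (upd x d s) = upd x c s"
  by (simp add: upd_def)

definition agree :: "com \<Rightarrow> state \<Rightarrow> state \<Rightarrow> bool" where
  "agree c s s' \<longleftrightarrow> (\<forall>x. x \<notin> writes c \<longrightarrow> reg s' x = reg s x) \<and>
     (\<forall>a. a \<notin> puts c \<longrightarrow> arr s' a = arr s a) \<and> (silent c \<longrightarrow> out s' = out s)"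

lemma agree_sem: "agree c s (sem c s)"
  by (simp add: agree_def reg_sem arr_sem out_sem)

lemma agreeD:
  assumes "agree c s s'"
  shows "x \<notin> writes c \<Longrightarrow> reg s' x = reg s x" "a \<notin> puts c \<Longrightarrow> arr s' a = arr s a"
    "silent c \<Longrightarrow> out s' = out s"
  using assms by (auto simp: agree_def)

lemma sem_For:
  assumes "reg s b = int n" "I 0 s"
    and "\<And>j s'. j < n \<Longrightarrow> I j s' \<Longrightarrow> reg s' i = int j \<Longrightarrow>
      agree (For i b c) s s' \<Longrightarrow> I (Suc j) (sem c s')"
    and "\<And>j x s'. I j s' \<Longrightarrow> I j (upd i x s')"
  shows "I n (sem (For i b c) s)"
proof -
  let ?J = "\<lambda>j s'. I j s' \<and> agree (For i b c) s s'"
  have "?J n (fold (\<lambda>j s. sem c (upd i (int j) s)) [0..<n] s)"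
  proof (rule fold_invariant_upt[where P = ?J])
    show "?J 0 s" using assms(2) by (simp add: agree_def)
    fix j s' assume j: "j < n" "?J j s'"
    have "agree (For i b c) s (upd i (int j) s')" using j(2) by (simp add: agree_def)
    moreover from this have "agree (For i b c) s (sem c (upd i (int j) s'))"
      by (simp add: agree_def reg_sem arr_sem out_sem)
    ultimately show "?J (Suc j) (sem c (upd i (int j) s'))"
      using assms(3,4) j by simp
  qed
  then show ?thesis using assms(1,4) by (simp add: sem.simps(11))
qed

text \<open>
  Array 0 holds the incidence matrix, array 1 the set \<open>B\<close> of edges hit by the greedy set, array 2
  the kept vertices and array 3 the edges hit by these.  When the vertices in \<open>rU\<close> and \<open>rV\<close> are
  compared, \<open>rDA\<close> records whether they differ on any edge and \<open>rDB\<close> whether they differ on an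
  edge of \<open>B\<close>.
\<close>

abbreviation (input) "rK \<equiv> 2 :: nat"
abbreviation (input) "rN \<equiv> 3 :: nat"
abbreviation (input) "rM \<equiv> 4 :: nat"
abbreviation (input) "rE \<equiv> 5 :: nat"
abbreviation (input) "rV \<equiv> 6 :: nat"
abbreviation (input) "rU \<equiv> 7 :: nat"
abbreviation (input) "rT \<equiv> 8 :: nat"
abbreviation (input) "rP \<equiv> 9 :: nat"
abbreviation (input) "rD \<equiv> 10 :: nat"
abbreviation (input) "rX \<equiv> 11 :: nat"
abbreviation (input) "rY \<equiv> 12 :: nat"
abbreviation (input) "rH \<equiv> 13 :: nat"
abbreviation (input) "rNew \<equiv> 14 :: nat"
abbreviation (input) "rEx \<equiv> 15 :: nat"
abbreviation (input) "rOne \<equiv> 16 :: nat"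
abbreviation (input) "rQ \<equiv> 17 :: nat"
abbreviation (input) "rType \<equiv> 18 :: nat"
abbreviation (input) "rTwin \<equiv> 19 :: nat"
abbreviation (input) "rDB \<equiv> 20 :: nat"
abbreviation (input) "rDA \<equiv> 21 :: nat"
abbreviation (input) "rNK \<equiv> 22 :: nat"
abbreviation (input) "rNL \<equiv> 23 :: nat"

definition inc :: "nat \<Rightarrow> com" where
  "inc r = Set rOne 1 ;; Plus r r rOne"

text \<open>Computes \<open>e \<cdot> n + v\<close> without multiplication, using that \<open>e\<close> is at most \<open>m\<close>.\<close>

definition cell :: "nat \<Rightarrow> nat \<Rightarrow> nat \<Rightarrow> com" where
  "cell x e v = Set rP 0 ;; Plus rP rP v ;;
     For rT rM (Minus rD e rT ;; IfPos rD (Plus rP rP rN) Skip) ;; Get x 0 rP"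

definition fresh :: com where
  "fresh = Set rNew 0 ;; For rE rM (cell rX rE rV ;;
     IfPos rX (Get rH 1 rE ;; IfPos rH Skip (inc rNew)) Skip)"

definition mark :: "nat \<Rightarrow> com" where
  "mark a = For rE rM (cell rX rE rV ;; IfPos rX (Set rOne 1 ;; Put a rE rOne) Skip)"

definition greedy_com :: com where
  "greedy_com = Set rEx 0 ;; For rV rN (fresh ;; Set rOne 1 ;; Minus rD rNew rOne ;;
     IfPos rD (mark 1 ;; Set rOne 1 ;; Minus rD rNew rOne ;; Plus rEx rEx rD) Skip)"

definition differ :: com where
  "differ = Set rDA 1 ;; Get rH 1 rE ;; IfPos rH (Set rDB 1) Skip"

definition compare :: com where
  "compare = Set rDB 0 ;; Set rDA 0 ;; For rE rM (cell rX rE rU ;; cell rY rE rV ;;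
     Minus rD rX rY ;; IfPos rD differ (Minus rD rY rX ;; IfPos rD differ Skip))"

definition tally :: com where
  "tally = Set rType 0 ;; Set rTwin 0 ;; For rU rN (Get rH 2 rU ;;
     IfPos rH (compare ;; IfPos rDB Skip (inc rType) ;; IfPos rDA Skip (Set rTwin 1)) Skip)"

definition keep_com :: com where
  "keep_com = For rV rN (tally ;; IfPos rTwin Skip (Minus rD rType rK ;;
     IfPos rD Skip (Set rOne 1 ;; Put 2 rV rOne ;; mark 3)))"

definition size_com :: "nat \<Rightarrow> nat \<Rightarrow> nat \<Rightarrow> nat \<Rightarrow> com" where
  "size_com r a i b = Set r 0 ;; For i b (Get rH a i ;; IfPos rH (inc r) Skip)"

definition emit_row :: com where
  "emit_row = For rV rN (Get rH 2 rV ;; IfPos rH (cell rX rE rV ;; Output rX) Skip)"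

definition emit :: com where
  "emit = Output rK ;; Output rNK ;; Output rNL ;;
     For rE rM (Get rH 3 rE ;; IfPos rH emit_row Skip)"

definition prelude :: com where
  "prelude = Input rK ;; Input rN ;; Input rM ;; IfPos rM Skip (Set rN 1)"

definition read_row :: com where
  "read_row = For rV rN (Input rX ;; Put 0 rQ rX ;; inc rQ)"

definition read_matrix :: com where
  "read_matrix = Set rQ 0 ;; For rE rM read_row"

definition main :: com where
  "main = read_matrix ;; greedy_com ;; Minus rD rK rEx ;;
     IfPos rD (keep_com ;; size_com rNK 2 rV rN ;; size_com rNL 3 rE rM ;; emit)
       (Set rX 0 ;; Set rOne 1 ;; Output rX ;; Output rOne ;; Output rX)"

lemma writes_simps [simp]:
  "writes (inc r) = {rOne, r}"
  "writes (cell x e v) = {rP, rT, rD, x}"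
  "writes fresh = {rP, rT, rD, rX, rE, rH, rNew, rOne}"
  "writes (mark a) = {rP, rT, rD, rX, rE, rOne}"
  "writes greedy_com = {rP, rT, rD, rX, rE, rH, rNew, rOne, rV, rEx}"
  "writes differ = {rDA, rDB, rH}"
  "writes compare = {rP, rT, rD, rX, rY, rE, rH, rDA, rDB}"
  "writes tally = {rP, rT, rD, rX, rY, rE, rH, rDA, rDB, rU, rOne, rType, rTwin}"
  "writes keep_com = {rP, rT, rD, rX, rY, rE, rH, rDA, rDB, rU, rOne, rType, rTwin, rV}"
  "writes (size_com r a i b) = {r, i, rH, rOne}"
  "writes emit_row = {rP, rT, rD, rX, rV, rH}"
  "writes read_row = {rX, rOne, rQ, rV}"
  by (auto simp: inc_def cell_def fresh_def mark_def greedy_com_def differ_def compare_def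
    tally_def keep_com_def size_com_def emit_row_def read_row_def)

lemma puts_simps [simp]:
  "puts (inc r) = {}" "puts (cell x e v) = {}" "puts fresh = {}" "puts (mark a) = {a}"
  "puts greedy_com = {1}" "puts differ = {}" "puts compare = {}" "puts tally = {}"
  "puts keep_com = {2, 3}" "puts (size_com r a i b) = {}" "puts emit_row = {}"
  "puts read_row = {0}"
  by (auto simp: inc_def cell_def fresh_def mark_def greedy_com_def differ_def compare_def
    tally_def keep_com_def size_com_def emit_row_def read_row_def)

lemma silent_simps [simp]:
  "silent (inc r)" "silent (cell x e v)" "silent fresh" "silent (mark a)" "silent greedy_com"
  "silent differ" "silent compare" "silent tally" "silent keep_com" "silent (size_com r a i b)"
  "silent read_row"
  by (auto simp: inc_def cell_def fresh_def mark_def greedy_com_def differ_def compare_def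
    tally_def keep_com_def size_com_def read_row_def)

lemma ok_prelude: "ok {} prelude"
  by (simp add: prelude_def var_def)

lemma ok_main: "ok {rN, rM} main"
  by (simp add: main_def read_matrix_def read_row_def greedy_com_def fresh_def cell_def inc_def
    mark_def keep_com_def tally_def compare_def differ_def size_com_def emit_def emit_row_def
    var_def)

lemma reg_inc [simp]: "r \<noteq> rOne \<Longrightarrow> reg (sem (inc r) s) r = reg s r + 1"
  by (simp add: inc_def)

definition loaded :: "nat \<Rightarrow> nat set list \<Rightarrow> int \<Rightarrow> state \<Rightarrow> bool" where
  "loaded n F k s \<longleftrightarrow> reg s rN = int n \<and> reg s rM = int (length F) \<and> reg s rK = k \<and>
     (\<forall>e<length F. \<forall>v<n. arr s 0 (e * n + v) = of_bool (v \<in> F ! e))"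

definition holds_set :: "state \<Rightarrow> nat \<Rightarrow> nat \<Rightarrow> nat set \<Rightarrow> bool" where
  "holds_set s a l S \<longleftrightarrow> (\<forall>i<l. arr s a i = of_bool (i \<in> S))"

lemma loadedD:
  assumes "loaded n F k s"
  shows "reg s rN = int n" "reg s rM = int (length F)" "reg s rK = k"
  using assms by (simp_all add: loaded_def)

lemma loaded_agree:
  assumes "loaded n F k s" "agree c s s'" "rN \<notin> writes c" "rM \<notin> writes c" "rK \<notin> writes c"
    "0 \<notin> puts c"
  shows "loaded n F k s'"
  using assms by (simp add: loaded_def agree_def)

lemma loaded_upd [simp]:
  "x \<noteq> rN \<Longrightarrow> x \<noteq> rM \<Longrightarrow> x \<noteq> rK \<Longrightarrow> loaded n F k (upd x c s) = loaded n F k s"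
  by (simp add: loaded_def)

lemma holds_set_agree:
  assumes "holds_set s a l S" "agree c s s'" "a \<notin> puts c"
  shows "holds_set s' a l S"
  using assms by (simp add: holds_set_def agree_def)

lemma holds_set_upd [simp]: "holds_set (upd x c s) a l S = holds_set s a l S"
  by (simp add: holds_set_def)

lemmas loaded_sem = loaded_agree[OF _ agree_sem]
lemmas holds_set_sem = holds_set_agree[OF _ agree_sem]

lemma sem_cell:
  assumes "loaded n F k s" "reg s e = int e0" "reg s v = int v0" "e0 < length F" "v0 < n"
    and "e \<notin> {rP, rT, rD}" "v \<notin> {rP, rT, rD}"
  shows "reg (sem (cell x e v) s) x = of_bool (v0 \<in> F ! e0)"
proof -
  let ?s = "upd rP (int v0) s"
  let ?c = "Minus rD e rT ;; IfPos rD (Plus rP rP rN) Skip"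
  have "reg (sem (For rT rM ?c) ?s) rP = int (v0 + min (length F) e0 * n)"
  proof (rule sem_For[where I = "\<lambda>j s'. reg s' rP = int (v0 + min j e0 * n)"])
    fix j s' assume "reg s' rP = int (v0 + min j e0 * n)" "reg s' rT = int j"
      "agree (For rT rM ?c) ?s s'"
    moreover from this(3) have "reg s' rN = int n" "reg s' e = int e0"
      using assms by (auto simp: agree_def loaded_def)
    ultimately show "reg (sem ?c s') rP = int (v0 + min (Suc j) e0 * n)"
      using assms(6) by (auto simp: min_def algebra_simps)
  qed (use assms in \<open>auto simp: loaded_def\<close>)
  then have "nat (reg (sem (For rT rM ?c) ?s) rP) = e0 * n + v0"
    using assms(4) by (simp only: nat_int min_absorb2 less_imp_le add.commute)
  then show ?thesis
    using assms(1,3,4,5,7) by (simp add: cell_def loaded_def arr_sem)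
qed

lemma card_Int_lessThan_Suc:
  "card (A \<inter> {..<Suc j}) = card (A \<inter> {..<j}) + of_bool (j \<in> A)"
proof -
  have "A \<inter> {..<Suc j} = (if j \<in> A then insert j (A \<inter> {..<j}) else A \<inter> {..<j})"
    by (auto simp: less_Suc_eq)
  then show ?thesis by simp
qed

lemma mem_hits_singleton: "e < length F \<Longrightarrow> e \<in> hits F {v} \<longleftrightarrow> v \<in> F ! e"
  by (simp add: hits_def)

lemma sem_fresh:
  assumes "loaded n F k s" "reg s rV = int v" "v < n" "holds_set s 1 (length F) B"
  shows "reg (sem fresh s) rNew = int (card (hits F {v} - B))"
proof -
  let ?A = "hits F {v} - B"
  let ?s = "upd rNew 0 s"
  let ?c = "cell rX rE rV ;; IfPos rX (Get rH 1 rE ;; IfPos rH Skip (inc rNew)) Skip"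
  have "reg (sem (For rE rM ?c) ?s) rNew = int (card (?A \<inter> {..<length F}))"
  proof (rule sem_For[where I = "\<lambda>j s'. reg s' rNew = int (card (?A \<inter> {..<j}))"])
    fix j s' assume j: "j < length F" "reg s' rNew = int (card (?A \<inter> {..<j}))"
      "reg s' rE = int j" "agree (For rE rM ?c) ?s s'"
    have l: "loaded n F k s'" using assms(1) by (intro loaded_agree[OF _ j(4)]) auto
    have v: "reg s' rV = int v" using agreeD(1)[OF j(4)] assms(2) by simp
    have "arr s' 1 j = of_bool (j \<in> B)"
      using agreeD(2)[OF j(4)] assms(4) j(1) by (simp add: holds_set_def)
    then show "reg (sem ?c s') rNew = int (card (?A \<inter> {..<Suc j}))"
      using sem_cell[OF l j(3) v j(1) assms(3), of rX] j(1,2,3)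
      by (simp add: reg_sem arr_sem card_Int_lessThan_Suc mem_hits_singleton)
  qed (use loadedD[OF assms(1)] in auto)
  moreover have "?A \<inter> {..<length F} = ?A" using hits_subset by blast
  ultimately show ?thesis by (simp add: fresh_def)
qed

lemma sem_mark:
  assumes "loaded n F k s" "reg s rV = int v" "v < n" "holds_set s a (length F) B" "a \<noteq> 0"
  shows "holds_set (sem (mark a) s) a (length F) (hits F {v} \<union> B)"
proof -
  let ?c = "cell rX rE rV ;; IfPos rX (Set rOne 1 ;; Put a rE rOne) Skip"
  let ?I = "\<lambda>j s'. \<forall>i<length F. arr s' a i = of_bool (i \<in> B \<or> i < j \<and> i \<in> hits F {v})"
  have "?I (length F) (sem (For rE rM ?c) s)"
  proof (rule sem_For[where I = ?I])
    show "?I 0 s" using assms(4) by (simp add: holds_set_def)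
    fix j s' assume j: "j < length F" "?I j s'"
      "reg s' rE = int j" "agree (For rE rM ?c) s s'"
    have l: "loaded n F k s'" using assms(1,5) by (intro loaded_agree[OF _ j(4)]) auto
    have v: "reg s' rV = int v" using agreeD(1)[OF j(4)] assms(2) by simp
    show "?I (Suc j) (sem ?c s')"
      using sem_cell[OF l j(3) v j(1) assms(3), of rX] j(1,2,3)
      by (auto simp: reg_sem arr_sem less_Suc_eq mem_hits_singleton)
  qed (use loadedD[OF assms(1)] in auto)
  then show ?thesis by (auto simp: mark_def holds_set_def)
qed

lemma sem_greedy_com:
  assumes "loaded n F k s" "holds_set s 1 (length F) {}"
  shows "holds_set (sem greedy_com s) 1 (length F) (hits F (greedy F n))"
    "reg (sem greedy_com s) rEx = excess F (greedy F n)"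
proof -
  let ?s = "upd rEx 0 s"
  let ?d = "mark 1 ;; Set rOne 1 ;; Minus rD rNew rOne ;; Plus rEx rEx rD"
  let ?c = "fresh ;; Set rOne 1 ;; Minus rD rNew rOne ;; IfPos rD ?d Skip"
  let ?I = "\<lambda>j s'. holds_set s' 1 (length F) (hits F (greedy F j)) \<and>
    reg s' rEx = excess F (greedy F j)"
  have "?I n (sem (For rV rN ?c) ?s)"
  proof (rule sem_For[where I = ?I])
    show "?I 0 ?s" using assms(2) by (simp add: excess_def)
    fix j s' assume j: "j < n" "?I j s'" "reg s' rV = int j" "agree (For rV rN ?c) ?s s'"
    let ?G = "greedy F j"
    let ?new = "card (hits F {j} - hits F ?G)"
    have l: "loaded n F k s'" using assms(1) by (intro loaded_agree[OF _ j(4)]) auto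
    define t where "t = upd rD (int ?new - 1) (upd rOne 1 (sem fresh s'))"
    have new: "reg (sem fresh s') rNew = int ?new"
      using sem_fresh[OF l j(3,1)] j(2) by blast
    have t: "loaded n F k t" "reg t rV = int j" "holds_set t 1 (length F) (hits F ?G)"
      "reg t rEx = excess F ?G" "reg t rNew = int ?new"
      using l j(2,3) new by (simp_all add: t_def reg_sem loaded_sem holds_set_sem)
    have sem: "sem ?c s' = (if 1 < ?new then sem ?d t else t)"
      using new by (simp add: t_def)
    show "?I (Suc j) (sem ?c s')"
    proof (cases "1 < ?new")
      case True
      then have "greedy F (Suc j) = insert j ?G" by simp
      moreover have "holds_set (sem ?d t) 1 (length F) (hits F (insert j ?G))"
        using sem_mark[OF t(1,2) j(1) t(3)] by (simp add: hits_insert[of F j ?G])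
      moreover have "reg (sem ?d t) rEx = excess F (insert j ?G)"
        using t by (simp add: reg_sem excess_greedy_Suc)
      ultimately show ?thesis using sem True by (simp only: if_True simp_thms)
    next
      case False
      then have "greedy F (Suc j) = ?G" by simp
      then show ?thesis using sem False t by (simp only: if_False simp_thms)
    qed
  qed (use loadedD[OF assms(1)] in auto)
  then show "holds_set (sem greedy_com s) 1 (length F) (hits F (greedy F n))"
    "reg (sem greedy_com s) rEx = excess F (greedy F n)"
    by (simp_all add: greedy_com_def)
qed

lemma sem_differ:
  assumes "holds_set s 1 m B" "reg s rE = int e" "e < m"
  shows "reg (sem differ s) rDA = 1"
    "reg (sem differ s) rDB = (if e \<in> B then 1 else reg s rDB)"
  using assms by (simp_all add: differ_def holds_set_def)

lemma hits_eq_iff: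
  "hits F {u} \<noteq> hits F {v} \<longleftrightarrow> (\<exists>e<length F. (u \<in> F ! e) \<noteq> (v \<in> F ! e))"
  "hits F {u} \<inter> B \<noteq> hits F {v} \<inter> B \<longleftrightarrow>
    (\<exists>e<length F. e \<in> B \<and> (u \<in> F ! e) \<noteq> (v \<in> F ! e))"
  by (auto simp: hits_def set_eq_iff)

lemma sem_compare:
  assumes "loaded n F k s" "reg s rU = int u" "reg s rV = int v" "u < n" "v < n"
    and "holds_set s 1 (length F) B"
  shows "reg (sem compare s) rDA = of_bool (hits F {u} \<noteq> hits F {v})"
    "reg (sem compare s) rDB = of_bool (\<not> same_type F B u v)"
proof -
  let ?s = "upd rDA 0 (upd rDB 0 s)"
  let ?d = "Minus rD rX rY ;; IfPos rD differ (Minus rD rY rX ;; IfPos rD differ Skip)"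
  let ?c = "cell rX rE rU ;; cell rY rE rV ;; ?d"
  let ?P = "\<lambda>e. (u \<in> F ! e) \<noteq> (v \<in> F ! e)"
  let ?I = "\<lambda>j s'. reg s' rDA = of_bool (\<exists>e<j. ?P e) \<and>
    reg s' rDB = of_bool (\<exists>e<j. e \<in> B \<and> ?P e)"
  have "?I (length F) (sem (For rE rM ?c) ?s)"
  proof (rule sem_For[where I = ?I])
    fix j s' assume j: "j < length F" "?I j s'" "reg s' rE = int j"
      "agree (For rE rM ?c) ?s s'"
    have l: "loaded n F k s'" using assms(1) by (intro loaded_agree[OF _ j(4)]) auto
    have uv: "reg s' rU = int u" "reg s' rV = int v"
      using agreeD(1)[OF j(4)] assms(2,3) by simp_all
    have B: "holds_set s' 1 (length F) B"
      using assms(6) by (intro holds_set_agree[OF _ j(4)]) auto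
    define t where "t = sem (cell rY rE rV) (sem (cell rX rE rU) s')"
    have l': "loaded n F k (sem (cell rX rE rU) s')" using l by (intro loaded_sem) auto
    have t: "reg t rX = of_bool (u \<in> F ! j)" "reg t rY = of_bool (v \<in> F ! j)"
      "reg t rE = int j" "reg t rDA = reg s' rDA" "reg t rDB = reg s' rDB"
      "holds_set t 1 (length F) B"
      using sem_cell[OF l j(3) uv(1) j(1) assms(4), of rX]
        sem_cell[OF l', of rE j rV v rY] j(1,3) uv(2) assms(5) B
      by (simp_all add: t_def reg_sem holds_set_sem)
    have "sem ?d t = (let t' = upd rD (reg t rX - reg t rY) t in
        if reg t rX > reg t rY then sem differ t'
        else if reg t rY > reg t rX then sem differ (upd rD (reg t rY - reg t rX) t')
        else upd rD (reg t rY - reg t rX) t')"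
      by (simp add: Let_def)
    then have "reg (sem ?d t) rDA = (if ?P j then 1 else reg t rDA) \<and>
        reg (sem ?d t) rDB = (if ?P j \<and> j \<in> B then 1 else reg t rDB)"
      using t j(1) sem_differ[of _ "length F" B j] by (auto simp: Let_def)
    then show "?I (Suc j) (sem ?c s')"
      using j(2) t(4,5) by (auto simp: t_def[symmetric] less_Suc_eq)
  qed (use loadedD[OF assms(1)] in auto)
  then show "reg (sem compare s) rDA = of_bool (hits F {u} \<noteq> hits F {v})"
    "reg (sem compare s) rDB = of_bool (\<not> same_type F B u v)"
    by (simp_all only: hits_eq_iff compare_def sem.simps)
qed

lemma sem_tally:
  assumes "loaded n F k s" "reg s rV = int v" "v < n" "K \<subseteq> {..<n}"
    and "holds_set s 1 (length F) B" "holds_set s 2 n K"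
  shows "reg (sem tally s) rType = int (card {u \<in> K. same_type F B u v})"
    "reg (sem tally s) rTwin = of_bool (\<exists>u\<in>K. hits F {u} = hits F {v})"
proof -
  let ?A = "{u \<in> K. same_type F B u v}"
  let ?s = "upd rTwin 0 (upd rType 0 s)"
  let ?d = "compare ;; IfPos rDB Skip (inc rType) ;; IfPos rDA Skip (Set rTwin 1)"
  let ?c = "Get rH 2 rU ;; IfPos rH ?d Skip"
  let ?I = "\<lambda>j s'. reg s' rType = int (card (?A \<inter> {..<j})) \<and>
    reg s' rTwin = of_bool (\<exists>u<j. u \<in> K \<and> hits F {u} = hits F {v})"
  have "?I n (sem (For rU rN ?c) ?s)"
  proof (rule sem_For[where I = ?I])
    fix j s' assume j: "j < n" "?I j s'" "reg s' rU = int j"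
      "agree (For rU rN ?c) ?s s'"
    define t where "t = upd rH (of_bool (j \<in> K)) s'"
    have l: "loaded n F k t"
      unfolding t_def using assms(1) by (simp, intro loaded_agree[OF _ j(4)]) auto
    have v: "reg t rV = int v" "reg t rU = int j"
      using agreeD(1)[OF j(4)] assms(2) j(3) by (simp_all add: t_def)
    have B: "holds_set t 1 (length F) B"
      unfolding t_def using assms(5) by (simp, intro holds_set_agree[OF _ j(4)]) auto
    have "arr s' 2 j = of_bool (j \<in> K)"
      using agreeD(2)[OF j(4)] assms(6) j(1) by (simp add: holds_set_def)
    then have sem: "sem ?c s' = (if j \<in> K then sem ?d t else t)"
      using j(3) by (simp add: t_def)
    have t: "reg t rType = int (card (?A \<inter> {..<j}))"
      "reg t rTwin = of_bool (\<exists>u<j. u \<in> K \<and> hits F {u} = hits F {v})"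
      using j(2) by (simp_all add: t_def)
    show "?I (Suc j) (sem ?c s')"
    proof (cases "j \<in> K")
      case True
      have "reg (sem ?d t) rType = reg t rType + of_bool (same_type F B j v) \<and>
          reg (sem ?d t) rTwin = (if hits F {j} = hits F {v} then 1 else reg t rTwin)"
        using sem_compare[OF l v(2,1) j(1) assms(3) B] by (simp add: reg_sem)
      then show ?thesis
        unfolding sem using True t by (auto simp: card_Int_lessThan_Suc less_Suc_eq)
    next
      case False
      then show ?thesis
        unfolding sem using t by (auto simp: card_Int_lessThan_Suc less_Suc_eq)
    qed
  qed (use loadedD[OF assms(1)] in auto)
  moreover have "?A \<inter> {..<n} = ?A" using assms(4) by blast
  moreover have "(\<exists>u<n. u \<in> K \<and> hits F {u} = hits F {v}) \<longleftrightarrow> (\<exists>u\<in>K. hits F {u} = hits F {v})"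
    using assms(4) by auto
  ultimately show "reg (sem tally s) rType = int (card ?A)"
    "reg (sem tally s) rTwin = of_bool (\<exists>u\<in>K. hits F {u} = hits F {v})"
    by (simp_all only: tally_def sem.simps)
qed

lemma sem_keep_com:
  assumes "loaded n F k s" "holds_set s 1 (length F) B" "holds_set s 2 n {}"
    "holds_set s 3 (length F) {}"
  shows "holds_set (sem keep_com s) 2 n (keep F k B n)"
    "holds_set (sem keep_com s) 3 (length F) (hits F (keep F k B n))"
proof -
  let ?e = "Set rOne 1 ;; Put 2 rV rOne ;; mark 3"
  let ?d = "Minus rD rType rK ;; IfPos rD Skip ?e"
  let ?c = "tally ;; IfPos rTwin Skip ?d"
  let ?I = "\<lambda>j s'. holds_set s' 2 n (keep F k B j) \<and>
    holds_set s' 3 (length F) (hits F (keep F k B j))"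
  have "?I n (sem (For rV rN ?c) s)"
  proof (rule sem_For[where I = ?I])
    show "?I 0 s" using assms(3,4) by simp
    fix j s' assume j: "j < n" "?I j s'" "reg s' rV = int j"
      "agree (For rV rN ?c) s s'"
    let ?K = "keep F k B j"
    let ?tp = "int (card {u \<in> ?K. same_type F B u j})"
    let ?accept = "(\<forall>u\<in>?K. hits F {u} \<noteq> hits F {j}) \<and> ?tp \<le> k"
    have l: "loaded n F k s'" using assms(1) by (intro loaded_agree[OF _ j(4)]) auto
    have B: "holds_set s' 1 (length F) B"
      using assms(2) by (intro holds_set_agree[OF _ j(4)]) auto
    define t where "t = sem tally s'"
    have K: "?K \<subseteq> {..<n}" using keep_subset[of F k B j] j(1) by auto
    note tally = sem_tally[OF l j(3,1) K B conjunct1[OF j(2)], folded t_def]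
    have t: "loaded n F k t" "reg t rV = int j" "holds_set t 2 n ?K"
      "holds_set t 3 (length F) (hits F ?K)"
      using l j(2,3) by (simp_all add: t_def reg_sem loaded_sem holds_set_sem)
    define t' where "t' = upd rD (?tp - k) t"
    have t': "loaded n F k t'" "reg t' rV = int j" "holds_set t' 2 n ?K"
      "holds_set t' 3 (length F) (hits F ?K)"
      using t by (simp_all add: t'_def)
    have sem: "sem ?c s' = (if \<exists>u\<in>?K. hits F {u} = hits F {j} then t
        else if ?tp \<le> k then sem ?e t' else t')"
      using tally loadedD(3)[OF t(1)] by (auto simp: t'_def t_def[symmetric])
    show "?I (Suc j) (sem ?c s')"
    proof (cases ?accept)
      case True
      then have eq: "keep F k B (Suc j) = insert j ?K" unfolding keep.simps by (rule if_P)
      define r where "r = sem (Set rOne 1 ;; Put 2 rV rOne) t'"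
      have r: "loaded n F k r" "reg r rV = int j" "holds_set r 2 n (insert j ?K)"
        "holds_set r 3 (length F) (hits F ?K)"
        using t' by (auto simp: r_def loaded_def holds_set_def)
      have "sem ?c s' = sem (mark 3) r"
        unfolding sem using True by (auto simp: r_def)
      then show ?thesis
        unfolding eq using sem_mark[OF r(1,2) j(1) r(4)] holds_set_sem[OF r(3), of "mark 3"]
        by (simp add: hits_insert[of F j ?K])
    next
      case False
      then have "keep F k B (Suc j) = ?K" unfolding keep.simps by (rule if_not_P)
      moreover have "sem ?c s' = t \<or> sem ?c s' = t'"
        unfolding sem using False by auto
      ultimately show ?thesis using t t' by (metis (no_types))
    qed
  qed (use loadedD[OF assms(1)] in auto)
  then show "holds_set (sem keep_com s) 2 n (keep F k B n)"
    "holds_set (sem keep_com s) 3 (length F) (hits F (keep F k B n))"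
    by (simp_all add: keep_com_def)
qed

lemma sem_size_com:
  assumes "reg s b = int l" "holds_set s a l S" "S \<subseteq> {..<l}"
    and "distinct [r, i, b, rH, rOne]"
  shows "reg (sem (size_com r a i b) s) r = int (card S)"
proof -
  let ?s = "upd r 0 s"
  let ?c = "Get rH a i ;; IfPos rH (inc r) Skip"
  have "reg (sem (For i b ?c) ?s) r = int (card (S \<inter> {..<l}))"
  proof (rule sem_For[where I = "\<lambda>j s'. reg s' r = int (card (S \<inter> {..<j}))"])
    fix j s' assume j: "j < l" "reg s' r = int (card (S \<inter> {..<j}))"
      "reg s' i = int j" "agree (For i b ?c) ?s s'"
    have "arr s' a j = of_bool (j \<in> S)"
      using agreeD(2)[OF j(4)] assms(2) j(1) by (simp add: holds_set_def)
    then show "reg (sem ?c s') r = int (card (S \<inter> {..<Suc j}))"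
      using j(2,3) assms(4) by (simp add: card_Int_lessThan_Suc)
  qed (use assms in auto)
  moreover have "S \<inter> {..<l} = S" using assms(3) by blast
  ultimately show ?thesis by (simp add: size_com_def)
qed

lemma sem_emit_row:
  assumes "loaded n F k s" "holds_set s 2 n K" "reg s rE = int e" "e < length F"
  shows "out (sem emit_row s) =
    out s @ map (\<lambda>v. of_bool (v \<in> F ! e)) (filter (\<lambda>v. v \<in> K) [0..<n])"
proof -
  let ?c = "Get rH 2 rV ;; IfPos rH (cell rX rE rV ;; Output rX) Skip"
  let ?I = "\<lambda>j s'. out s' =
    out s @ map (\<lambda>v. of_bool (v \<in> F ! e)) (filter (\<lambda>v. v \<in> K) [0..<j])"
  have "?I n (sem (For rV rN ?c) s)"
  proof (rule sem_For[where I = ?I])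
    fix j s' assume j: "j < n" "?I j s'" "reg s' rV = int j" "agree (For rV rN ?c) s s'"
    define t where "t = upd rH (of_bool (j \<in> K)) s'"
    have l: "loaded n F k t"
      unfolding t_def using assms(1) by (simp, intro loaded_agree[OF _ j(4)]) auto
    have e: "reg t rE = int e" "reg t rV = int j"
      using agreeD(1)[OF j(4)] assms(3) j(3) by (simp_all add: t_def)
    have "arr s' 2 j = of_bool (j \<in> K)"
      using agreeD(2)[OF j(4)] assms(2) j(1) by (simp add: holds_set_def)
    then have "sem ?c s' = (if j \<in> K then sem (cell rX rE rV ;; Output rX) t else t)"
      using j(3) by (simp add: t_def)
    moreover have "out t = out s'" by (simp add: t_def)
    ultimately show "?I (Suc j) (sem ?c s')"
      using sem_cell[OF l e assms(4) j(1), of rX] j(2) by (simp add: out_sem)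
  qed (use loadedD[OF assms(1)] in auto)
  then show ?thesis by (simp add: emit_row_def)
qed

lemma sem_emit:
  assumes "loaded n F k s" "holds_set s 2 n K" "holds_set s 3 (length F) L"
  shows "out (sem emit s) = out s @ [k, reg s rNK, reg s rNL] @
    concat (map (\<lambda>e. map (\<lambda>v. of_bool (v \<in> F ! e)) (filter (\<lambda>v. v \<in> K) [0..<n]))
      (filter (\<lambda>e. e \<in> L) [0..<length F]))"
proof -
  let ?s = "s\<lparr>out := out s @ [k, reg s rNK, reg s rNL]\<rparr>"
  let ?c = "Get rH 3 rE ;; IfPos rH emit_row Skip"
  let ?rows = "\<lambda>j. concat (map (\<lambda>e. map (\<lambda>v. of_bool (v \<in> F ! e)) (filter (\<lambda>v. v \<in> K) [0..<n]))
      (filter (\<lambda>e. e \<in> L) [0..<j]))"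
  let ?I = "\<lambda>j s'. out s' = out ?s @ ?rows j"
  have s: "loaded n F k ?s" "holds_set ?s 2 n K" "holds_set ?s 3 (length F) L"
    using assms by (simp_all add: loaded_def holds_set_def)
  have "?I (length F) (sem (For rE rM ?c) ?s)"
  proof (rule sem_For[where I = ?I])
    fix j s' assume j: "j < length F" "?I j s'" "reg s' rE = int j" "agree (For rE rM ?c) ?s s'"
    define t where "t = upd rH (of_bool (j \<in> L)) s'"
    have l: "loaded n F k t"
      unfolding t_def by (simp, intro loaded_agree[OF s(1) j(4)]) auto
    have K: "holds_set t 2 n K"
      unfolding t_def by (simp, intro holds_set_agree[OF s(2) j(4)]) auto
    have e: "reg t rE = int j" using j(3) by (simp add: t_def)
    have "arr s' 3 j = of_bool (j \<in> L)"
      using agreeD(2)[OF j(4)] s(3) j(1) by (simp add: holds_set_def)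
    then have "sem ?c s' = (if j \<in> L then sem emit_row t else t)"
      using j(3) by (simp add: t_def)
    moreover have "out t = out s'" by (simp add: t_def)
    ultimately show "?I (Suc j) (sem ?c s')"
      using sem_emit_row[OF l K e j(1)] j(2) by simp
  qed (use loadedD[OF s(1)] in auto)
  moreover have "sem emit s = sem (For rE rM ?c) ?s"
    using loadedD(3)[OF assms(1)] by (simp add: emit_def)
  ultimately show ?thesis by simp
qed

lemma sem_read_matrix:
  assumes "reg s rN = int n" "reg s rM = int m" "length (inp s) = m * n"
  shows "i < m * n \<Longrightarrow> arr (sem read_matrix s) 0 i = inp s ! i"
proof -
  let ?zs = "inp s"
  let ?d = "Input rX ;; Put 0 rQ rX ;; inc rQ"
  let ?I = "\<lambda>q (s' :: state). reg s' rQ = int q \<and> inp s' = drop q ?zs \<and> (\<forall>i<q. arr s' 0 i = ?zs ! i)"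
  have row: "?I (q + n) (sem read_row s')"
    if q: "q + n \<le> m * n" "?I q s'" "reg s' rN = int n" for q s'
    unfolding read_row_def
  proof (rule sem_For[where I = "\<lambda>j. ?I (q + j)"])
    fix j t assume j: "j < n" "?I (q + j) t"
    have "q + j < length ?zs" using q(1) j(1) assms(3) by simp
    then have "inp t = ?zs ! (q + j) # drop (Suc (q + j)) ?zs"
      using j(2) by (simp add: Cons_nth_drop_Suc)
    then show "?I (q + Suc j) (sem ?d t)"
      using j(2) by (auto simp: inc_def less_Suc_eq)
  qed (use q in auto)
  have "?I (m * n) (sem (For rE rM read_row) (upd rQ 0 s))"
  proof (rule sem_For[where I = "\<lambda>j. ?I (j * n)"])
    fix j s' assume j: "j < m" "?I (j * n) s'" "agree (For rE rM read_row) (upd rQ 0 s) s'"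
    have "Suc j * n \<le> m * n" using j(1) by (intro mult_right_mono) auto
    moreover have "reg s' rN = int n" using agreeD(1)[OF j(3)] assms(1) by simp
    ultimately show "?I (Suc j * n) (sem read_row s')"
      using row[of "j * n" s'] j(2) by (simp add: add.commute)
  qed (use assms in auto)
  then show "i < m * n \<Longrightarrow> arr (sem read_matrix s) 0 i = inp s ! i"
    by (simp add: read_matrix_def)
qed

lemma nth_concat_rows:
  assumes "e < length F" "v < n"
  shows "concat (map (\<lambda>f. map (g f) [0..<n]) F) ! (e * n + v) = g (F ! e) v"
  using assms
proof (induction F arbitrary: e)
  case (Cons f F)
  then show ?case
    by (cases e) (auto simp: nth_append)
qed simp

lemma length_concat_rows: "length (concat (map (\<lambda>f. map (g f) [0..<n]) F)) = length F * n"
  by (induction F) auto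

definition reduce :: "instance_HS \<Rightarrow> instance_HS" where
  "reduce = (\<lambda>(n, F, k). kernel (if F = [] then 1 else n) F k)"

lemma encode_induced:
  assumes "induced n F K = (n', F')" "K \<subseteq> {..<n}" "K \<noteq> {}"
  shows "encode_HS (n', F', k) = [k, int (card K), int (card (hits F K))] @
    concat (map (\<lambda>e. map (\<lambda>v. of_bool (v \<in> F ! e)) (filter (\<lambda>v. v \<in> K) [0..<n]))
      (filter (\<lambda>e. e \<in> hits F K) [0..<length F]))"
proof -
  let ?vs = "filter (\<lambda>v. v \<in> K) [0..<n]"
  have n': "n' = length ?vs" and F': "F' = map (\<lambda>e. {j. j < length ?vs \<and> ?vs ! j \<in> F ! e})
      (filter (\<lambda>e. e \<in> hits F K) [0..<length F])"
    using assms(1) by (auto simp: induced_def Let_def)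
  have "map (\<lambda>j. of_bool (j \<in> {j. j < length ?vs \<and> ?vs ! j \<in> F ! e})) [0..<n'] =
      map (\<lambda>v. of_bool (v \<in> F ! e) :: int) ?vs" for e
    by (rule nth_equalityI) (simp_all add: n')
  then show ?thesis
    using induced_correct(2,3)[OF assms(2,3,1)]
    by (simp add: encode_HS_def F' o_def)
qed

lemma sem_main:
  assumes "0 < n" "reg s rN = int n" "reg s rM = int (length F)" "reg s rK = k"
    and "inp s = concat (map (\<lambda>f. map (\<lambda>v. of_bool (v \<in> f)) [0..<n]) F)"
    and "\<And>a i. arr s a i = 0"
  shows "out (sem main s) = out s @ encode_HS (kernel n F k)"
proof -
  define s1 where "s1 = sem read_matrix s"
  have matrix: "arr s1 0 (e * n + v) = of_bool (v \<in> F ! e)" if "e < length F" "v < n" for e v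
  proof -
    have "Suc e * n \<le> length F * n" using that(1) by (intro mult_right_mono) auto
    then have "e * n + v < length F * n" using that(2) by simp
    then show ?thesis
      using sem_read_matrix[OF assms(2,3)] nth_concat_rows[OF that, of "\<lambda>f v. of_bool (v \<in> f) :: int"]
      by (simp add: s1_def assms(5) length_concat_rows)
  qed
  have w: "writes read_matrix = {rQ, rX, rOne, rV, rE}" "puts read_matrix = {0}" "silent read_matrix"
    by (auto simp: read_matrix_def)
  have s1: "loaded n F k s1" "holds_set s1 1 (length F) {}" "holds_set s1 2 n {}"
    "holds_set s1 3 (length F) {}" "out s1 = out s"
    using matrix assms w by (auto simp: loaded_def holds_set_def s1_def reg_sem arr_sem out_sem)
  let ?B = "hits F (greedy F n)" and ?ex = "excess F (greedy F n)"
  define s2 where "s2 = upd rD (k - ?ex) (sem greedy_com s1)"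
  note greedy = sem_greedy_com[OF s1(1,2)]
  have s2: "loaded n F k s2" "holds_set s2 1 (length F) ?B" "holds_set s2 2 n {}"
    "holds_set s2 3 (length F) {}" "out s2 = out s"
    using s1 greedy(1) by (simp_all add: s2_def loaded_sem holds_set_sem out_sem)
  let ?t = "keep_com ;; size_com rNK 2 rV rN ;; size_com rNL 3 rE rM ;; emit"
  let ?e = "Set rX 0 ;; Set rOne 1 ;; Output rX ;; Output rOne ;; Output rX"
  have "sem main s = (if ?ex < k then sem ?t s2 else sem ?e s2)"
    using greedy(2) loadedD(3)[OF s1(1)] by (simp add: main_def s1_def[symmetric] s2_def reg_sem)
  moreover have "out (sem ?e s2) = out s @ encode_HS (1, [], 0)"
    using s2(5) by (simp add: encode_HS_def)
  moreover have "out (sem ?t s2) = out s @ encode_HS (kernel n F k)" if "?ex < k"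
  proof -
    let ?K = "keep F k ?B n"
    define s3 where "s3 = sem keep_com s2"
    define s4 where "s4 = sem (size_com rNK 2 rV rN) s3"
    define s5 where "s5 = sem (size_com rNL 3 rE rM) s4"
    have s3: "loaded n F k s3" "holds_set s3 2 n ?K" "holds_set s3 3 (length F) (hits F ?K)"
      "out s3 = out s"
      using s2 sem_keep_com[OF s2(1-4)] by (simp_all add: s3_def loaded_sem out_sem)
    have s4: "loaded n F k s4" "holds_set s4 2 n ?K" "holds_set s4 3 (length F) (hits F ?K)"
      "out s4 = out s" "reg s4 rNK = int (card ?K)"
      using s3 sem_size_com[OF loadedD(1)[OF s3(1)] s3(2) keep_subset, of rNK rV]
      by (simp_all add: s4_def loaded_sem holds_set_sem out_sem)
    have s5: "loaded n F k s5" "holds_set s5 2 n ?K" "holds_set s5 3 (length F) (hits F ?K)"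
      "out s5 = out s" "reg s5 rNK = int (card ?K)" "reg s5 rNL = int (card (hits F ?K))"
      using s4 sem_size_com[OF loadedD(2)[OF s4(1)] s4(3) hits_subset, of rNL rE]
      by (simp_all add: s5_def loaded_sem holds_set_sem out_sem reg_sem)
    obtain n' F' where ind: "induced n F ?K = (n', F')" by fastforce
    have "0 \<le> k" using that card_greedy[of F n] by (simp add: excess_def)
    then have "encode_HS (n', F', k) = [k, reg s5 rNK, reg s5 rNL] @
        concat (map (\<lambda>e. map (\<lambda>v. of_bool (v \<in> F ! e)) (filter (\<lambda>v. v \<in> ?K) [0..<n]))
          (filter (\<lambda>e. e \<in> hits F ?K) [0..<length F]))"
      using encode_induced[OF ind keep_subset keep_nonempty[OF assms(1)]] s5(5,6) by simp
    moreover have "kernel n F k = (n', F', k)" using that ind by (simp add: kernel_def)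
    ultimately show ?thesis
      using sem_emit[OF s5(1-3)] s5(4) by (simp add: s3_def s4_def s5_def)
  qed
  moreover have "kernel n F k = (1, [], 0)" if "\<not> ?ex < k" using that by (simp add: kernel_def)
  ultimately show ?thesis by auto
qed

lemma initial_simps [simp]:
  "reg (initial xs) x = 0" "arr (initial xs) a i = 0" "inp (initial xs) = xs"
  "out (initial xs) = []"
  by (simp_all add: initial_def)

lemma sem_prelude:
  "sem prelude (initial (encode_HS (n, F, k))) =
    upd rN (if F = [] then 1 else int n) (upd rM (int (length F)) (upd rN (int n) (upd rK k
      (initial (concat (map (\<lambda>f. map (\<lambda>v. of_bool (v \<in> f)) [0..<n]) F))))))"
  by (auto simp: prelude_def encode_HS_def initial_def upd_def fun_eq_iff)

lemma input_size_ge: "length xs \<le> input_size xs"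
  by (induction xs) (simp_all add: input_size_def)

text \<open>
  For \<open>F = []\<close> the number of vertices may be exponential in the length of the input; replacing it
  by 1 keeps the loops over the vertices short.
\<close>

lemma polytime_reduce: "polytime_computable_on instances_HS encode_HS reduce"
proof -
  obtain C d where poly: "\<forall>N\<ge>1. cost N main \<le> C * N ^ d" using cost_polynomial by blast
  have "computes_within (compile (prelude ;; main) 0) (encode_HS x) (encode_HS (reduce x))
      ((C + cost 0 prelude) * input_size (encode_HS x) ^ d + (C + cost 0 prelude))"
    if "x \<in> instances_HS" for x
  proof -
    obtain n F k where x: "x = (n, F, k)" by (cases x)
    have hyp: "hypergraph {..<n} F" using that x by (simp add: instances_HS_def)
    then have "0 < n" by (auto simp: hypergraph_def)
    let ?n = "if F = [] then 1 else n"
    let ?N = "input_size (encode_HS x)"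
    let ?s = "sem prelude (initial (encode_HS x))"
    have "length (encode_HS x) = 3 + length F * n"
      by (simp add: x encode_HS_def length_concat_rows)
    then have N: "3 + length F * n \<le> ?N" using input_size_ge[of "encode_HS x"] by simp
    have F: "length F \<le> length F * n" "F \<noteq> [] \<Longrightarrow> n \<le> length F * n"
      using \<open>0 < n\<close> by (simp_all add: Suc_le_eq)
    then have bounds: "length F \<le> ?N" "1 \<le> ?N" using N by linarith+
    have n_bound: "?n \<le> ?N"
    proof (cases "F = []")
      case True
      then show ?thesis using bounds(2) by simp
    next
      case False
      then have "n \<le> ?N" using F(2) N by linarith
      then show ?thesis using False by simp
    qed
    have inp: "inp ?s = concat (map (\<lambda>f. map (\<lambda>v. of_bool (v \<in> f)) [0..<?n]) F)"
      by (simp add: x sem_prelude)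
    have "out (sem main ?s) = out ?s @ encode_HS (kernel ?n F k)"
      using \<open>0 < n\<close> by (intro sem_main inp) (simp_all add: x sem_prelude)
    then have out: "out (sem (prelude ;; main) (initial (encode_HS x))) = encode_HS (reduce x)"
      by (simp add: x sem_prelude reduce_def)
    have "cost 0 prelude + cost ?N main \<le>
        (C + cost 0 prelude) * ?N ^ d + (C + cost 0 prelude)"
      using poly bounds(2) by (simp add: add_mult_distrib trans_le_add1 add.commute add_mono)
    moreover have "\<forall>b\<in>{rN, rM}. reg ?s b \<le> int ?N"
      using bounds n_bound by (auto simp: x sem_prelude)
    ultimately show ?thesis
      using computes_within_compile[OF ok_prelude ok_main] out by metis
  qed
  then show ?thesis unfolding polytime_computable_on_def by blast
qed

lemma HS_yes_no_edges: "HS_yes V [] k \<longleftrightarrow> k \<le> 0"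
proof
  assume "k \<le> 0"
  then show "HS_yes V [] k" by (auto simp: HS_yes_def hitting_set_def intro!: exI[of _ "{}"])
qed (auto simp: HS_yes_def)

theorem theorem1:
  shows "\<exists>(f :: instance_HS \<Rightarrow> instance_HS) (g :: int \<Rightarrow> int).
    polytime_computable_on instances_HS encode_HS f \<and>
    (\<forall>n F k n' F' k'. (n, F, k) \<in> instances_HS \<and> f (n, F, k) = (n', F', k') \<longrightarrow>
      (n', F', k') \<in> instances_HS \<and>
      (HS_yes {..<n'} F' k' \<longleftrightarrow> HS_yes {..<n} F k) \<and>
      \<bar>k'\<bar> \<le> g k \<and>
      n' \<le> max 1 (nat k * 4 ^ nat k) \<and>
      length F' \<le> nat k * 4 ^ nat k)"
proof (intro exI conjI allI impI; (elim conjE)?)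
  show "polytime_computable_on instances_HS encode_HS reduce" by (rule polytime_reduce)
  fix n F k n' F' k'
  assume "(n, F, k) \<in> instances_HS" and r: "reduce (n, F, k) = (n', F', k')"
  then have hyp: "hypergraph {..<n} F" by (simp add: instances_HS_def)
  let ?n = "if F = [] then 1 else n"
  have hyp': "hypergraph {..<?n} F" using hyp by (auto simp: hypergraph_def)
  have yes: "HS_yes {..<?n} F k \<longleftrightarrow> HS_yes {..<n} F k" by (simp add: HS_yes_no_edges)
  have "kernel ?n F k = (n', F', k')" using r by (simp add: reduce_def)
  note kernel = kernel_correct[OF hyp' this]
  show "(n', F', k') \<in> instances_HS" using kernel(1) by (simp add: instances_HS_def)
  show "HS_yes {..<n'} F' k' \<longleftrightarrow> HS_yes {..<n} F k" using kernel(2) yes by blast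
  show "\<bar>k'\<bar> \<le> \<bar>k\<bar>" "n' \<le> max 1 (nat k * 4 ^ nat k)" "length F' \<le> nat k * 4 ^ nat k"
    by (fact kernel)+
qed

end
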